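(* For every integer $k>2^{100}$, we have $g(k)<2^{2000k}$. Equivalently, for $k>2^{100}$ and $n\ge 2^{2000k}$, every edge-coloring of the complete graph $K_n$ with $k$ colors contains a copy of $K_4$ whose six edges receive at most two distinct colors.
   Context: For a positive integer $k$, $g(k)$ denotes the largest positive integer $n$ for which there exists an edge-coloring of the complete graph $K_n$ using $k$ colors in which the edges of every copy of $K_4$ receive at least three distinct colors. *)

theory Defs
  imports "HOL-Library.Ramsey"
begin

text \<open>
  The complete graph \<open>K\<^sub>n\<close> has vertex set \<open>{..<n}\<close> and edge set \<open>[{..<n}]\<^bsup>2\<^esup>\<close>. An edge-colouring
  with \<open>k\<close> colours takes values in the palette \<open>{..<k}\<close>; not every colour need occur.
  Values of \<open>c\<close> off the edge set are irrelevant.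
\<close>

definition edge_coloring :: "nat \<Rightarrow> nat \<Rightarrow> (nat set \<Rightarrow> nat) \<Rightarrow> bool" where
  "edge_coloring n k c \<longleftrightarrow> c \<in> [{..<n}]\<^bsup>2\<^esup> \<rightarrow> {..<k}"

definition colors_on :: "(nat set \<Rightarrow> nat) \<Rightarrow> nat set \<Rightarrow> nat set" where
  "colors_on c S = c ` [S]\<^bsup>2\<^esup>"

definition every_K4_three_colors :: "nat \<Rightarrow> (nat set \<Rightarrow> nat) \<Rightarrow> bool" where
  "every_K4_three_colors n c \<longleftrightarrow> (\<forall>S \<in> [{..<n}]\<^bsup>4\<^esup>. card (colors_on c S) \<ge> 3)"

text \<open>
  \<open>Max\<close> is meaningful only when the set of admissible \<open>n\<close> is finite; a result about the value
  of \<open>g43\<close> should therefore come with a bound on that set.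
\<close>

definition g43 :: "nat \<Rightarrow> nat" where
  "g43 k = Max {n. n > 0 \<and> (\<exists>c. edge_coloring n k c \<and> every_K4_three_colors n c)}"

end

theory Submission
  imports Defs Complex_Main
begin

text \<open>
  Two consequences of the absence of a two-coloured \<open>K\<^sub>4\<close> are used. A colour is a matching inside
  each of its own neighbourhoods; and if all edges between \<open>X\<close> and \<open>W\<close> have one colour, then \<open>X\<close> and
  \<open>W\<close> span disjoint sets of colours. The first removes a colour at the cost of a bounded factor
  whenever some vertex has a colour of degree at least \<open>|Z| / 2\<^sup>3\<^sup>2\<close> in the current set \<open>Z\<close>.

  If no such vertex exists, there is a scale \<open>c\<close> such that a large proportion of the pairs of \<open>Z\<close> have
  colours of degree between \<open>|Z| / 2\<^sup>2\<^sup>c\<close> and \<open>|Z| / 2\<^sup>c\<close>. Take the colour \<open>b\<close> that is most frequent among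
  these pairs, with frequency about \<open>1 / 2\<^sup>l\<close>, and the set \<open>W\<close> of the vertices where \<open>b\<close> has degree at
  least \<open>|Z| / 2\<^sup>2\<^sup>c\<close>, and shrink \<open>Z\<close> to the vertices joined in colour \<open>b\<close> to many elements of \<open>W\<close>.
  Suppose that the same pair \<open>(c, l)\<close> occurs again later. Random tuples in the \<open>b\<close>-neighbourhoods of
  the elements of the old \<open>W\<close> within the new \<open>Z\<close> then see many new colours, because the pairs at
  scale \<open>c\<close> have colours of small degree and small frequency there. By averaging, a large part of \<open>W\<close>
  is completely joined in colour \<open>b\<close> to one such tuple and so loses all colours of the tuple. These
  are more colours than the old set allows, since it was chosen to maximise a potential. As there
  are only polylogarithmically many pairs \<open>(c, l)\<close>, the process costs little in total.
\<close>

section \<open>Colourful tuples\<close>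

lemma sum_PiE_split:
  assumes "finite I" "l \<in> I"
  shows "(\<Sum>x\<in>PiE I (\<lambda>_. S). F x) = (\<Sum>g\<in>PiE (I - {l}) (\<lambda>_. S). \<Sum>y\<in>S. F (g(l := y)))"
proof -
  have "PiE I (\<lambda>_. S) = PiE (insert l (I - {l})) (\<lambda>_. S)"
    using assms by (simp add: insert_absorb)
  also have "\<dots> = (\<lambda>(y, g). g(l := y)) ` (S \<times> PiE (I - {l}) (\<lambda>_. S))"
    by (subst PiE_insert_eq) simp
  finally have "PiE I (\<lambda>_. S) = (\<lambda>(y, g). g(l := y)) ` (S \<times> PiE (I - {l}) (\<lambda>_. S))" .
  moreover have "inj_on (\<lambda>(y, g). g(l := y)) (S \<times> PiE (I - {l}) (\<lambda>_. S))"
    using inj_combinator[of l "I - {l}" "\<lambda>_. S"] by simp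
  ultimately have "(\<Sum>x\<in>PiE I (\<lambda>_. S). F x) = (\<Sum>(y, g)\<in>S \<times> PiE (I - {l}) (\<lambda>_. S). F (g(l := y)))"
    by (simp add: sum.reindex case_prod_unfold)
  also have "\<dots> = (\<Sum>y\<in>S. \<Sum>g\<in>PiE (I - {l}) (\<lambda>_. S). F (g(l := y)))"
    by (simp add: sum.cartesian_product)
  also have "\<dots> = (\<Sum>g\<in>PiE (I - {l}) (\<lambda>_. S). \<Sum>y\<in>S. F (g(l := y)))"
    by (rule sum.swap)
  finally show ?thesis .
qed

lemma sum_PiE_two_coordinates:
  fixes F :: "'a \<Rightarrow> 'a \<Rightarrow> real"
  assumes "finite I" "i \<in> I" "l \<in> I" "i \<noteq> l"
  shows "(\<Sum>x\<in>PiE I (\<lambda>_. S). F (x i) (x l)) = real (card S) ^ (card I - 2) * (\<Sum>a\<in>S. \<Sum>b\<in>S. F a b)"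
proof -
  have "(\<Sum>x\<in>PiE I (\<lambda>_. S). F (x i) (x l)) = (\<Sum>g\<in>PiE (I - {l}) (\<lambda>_. S). \<Sum>b\<in>S. F (g i) b)"
    using assms by (subst sum_PiE_split[of _ l]) auto
  also have "\<dots> = (\<Sum>g\<in>PiE (I - {l} - {i}) (\<lambda>_. S). \<Sum>a\<in>S. \<Sum>b\<in>S. F a b)"
    using assms by (subst sum_PiE_split[of _ i]) auto
  also have "\<dots> = real (card (PiE (I - {l} - {i}) (\<lambda>_. S))) * (\<Sum>a\<in>S. \<Sum>b\<in>S. F a b)"
    by simp
  also have "card (PiE (I - {l} - {i}) (\<lambda>_. S)) = card S ^ (card I - 2)"
    using assms by (simp add: card_PiE numeral_2_eq_2)
  finally show ?thesis by simp
qed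

text \<open>Removing the first entry of every ordered collision makes \<open>f\<close> injective on
  the rest. The estimate is crude but suffices when collisions are rare.\<close>

lemma card_image_ge_minus_collisions:
  assumes "finite A"
  shows "real (card (f ` A)) \<ge> real (card A) - real (card {(a, b). a \<in> A \<and> b \<in> A \<and> a \<noteq> b \<and> f a = f b})"
proof -
  let ?B = "{(a, b). a \<in> A \<and> b \<in> A \<and> a \<noteq> b \<and> f a = f b}"
  have finB: "finite ?B"
    by (rule finite_subset[of _ "A \<times> A"]) (use assms in auto)
  have "inj_on f (A - fst ` ?B)"
  proof (rule inj_onI)
    fix x y assume h: "x \<in> A - fst ` ?B" "y \<in> A - fst ` ?B" "f x = f y"
    show "x = y"
    proof (rule ccontr)
      assume "x \<noteq> y"
      then have "(x, y) \<in> ?B" using h by auto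
      then have "x \<in> fst ` ?B" by (rule image_eqI[rotated]) simp
      then show False using h by blast
    qed
  qed
  then have "card (A - fst ` ?B) = card (f ` (A - fst ` ?B))"
    by (simp add: card_image)
  also have "\<dots> \<le> card (f ` A)"
    using assms by (intro card_mono) auto
  finally have "card (A - fst ` ?B) \<le> card (f ` A)" .
  moreover have "card A - card (fst ` ?B) \<le> card (A - fst ` ?B)"
    by (rule diff_card_le_card_Diff) (use finB in auto)
  moreover have "card (fst ` ?B) \<le> card ?B" using finB by (rule card_image_le)
  ultimately show ?thesis by linarith
qed

lemma card_lt_pairs:
  "2 * card {(i, j). i < j \<and> j < (q::nat)} = q * (q - 1)" "finite {(i, j). i < j \<and> j < (q::nat)}"
proof -
  have eq: "{(i, j). i < j \<and> j < q} = (\<lambda>(j, i). (i, j)) ` (SIGMA j:{..<q}. {..<j})"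
    by (auto simp: image_iff)
  have "card {(i, j). i < j \<and> j < q} = (\<Sum>j<q. j)"
    unfolding eq by (subst card_image) (auto simp: inj_on_def)
  moreover have "2 * (\<Sum>j<q. j) = q * (q - 1)"
  proof (induction q)
    case (Suc q)
    then show ?case by (cases q) auto
  qed simp
  ultimately show "2 * card {(i, j). i < j \<and> j < (q::nat)} = q * (q - 1)" by simp
  show "finite {(i, j). i < j \<and> j < (q::nat)}" unfolding eq by auto
qed

text \<open>For a uniform random \<open>q\<close>-tuple in \<open>S\<close>, the expected number of
  colour collisions is at most half the expected number of index pairs that fall into
  \<open>E\<close>. The expected number of distinct colours is therefore at least
  \<open>\<mu> / 2\<close> times the number \<open>q * (q - 1) / 2\<close> of index pairs. As it
  never exceeds that number, a reverse Markov inequality gives many colourful tuples.\<close>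

lemma many_colourful_tuples:
  fixes S :: "'v set" and f :: "'v \<Rightarrow> 'v \<Rightarrow> 'c" and \<mu> :: real
  assumes fin: "finite S" and sub: "E \<subseteq> S \<times> S" and symE: "sym E" and symf: "\<And>x y. f x y = f y x"
    and deg: "\<And>x b. x \<in> S \<Longrightarrow> real (card {y \<in> S. (x, y) \<in> E \<and> f x y = b}) * 2 ^ c \<le> real (card S)"
    and mass: "\<mu> * real (card S) ^ 2 \<le> real (card E)"
    and q: "2 \<le> q" "q * (q - 1) \<le> 2 ^ c"
  shows "\<mu> / 4 * real (card S) ^ q
    \<le> real (card {x \<in> PiE {..<q} (\<lambda>_. S).
        \<mu> * real (q * (q - 1)) / 8 \<le> real (card {f (x i) (x j) | i j. i < j \<and> j < q \<and> (x i, x j) \<in> E})})"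
proof -
  define \<Omega> where "\<Omega> = PiE {..<q} (\<lambda>_. S)"
  define N where "N = real (card S)"
  define I where "I = {(i, j). i < j \<and> j < q}"
  define P where "P = real (card I)"
  define A where "A x = {p \<in> I. (x (fst p), x (snd p)) \<in> E}" for x
  define g where "g x p = f (x (fst p)) (x (snd p))" for x :: "nat \<Rightarrow> 'v" and p
  define B where "B x = {(p, p'). p \<in> A x \<and> p' \<in> A x \<and> p \<noteq> p' \<and> g x p = g x p'}" for x
  define D where "D x = {f (x i) (x j) | i j. i < j \<and> j < q \<and> (x i, x j) \<in> E}" for x
  \<comment> \<open>Expectations are kept as unnormalised sums over tuples: \<open>a\<close> counts
    the tuples for which one fixed index pair falls into \<open>E\<close>.\<close>
  define a where "a = N ^ (q - 2) * real (card E)"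
  have finI: "finite I" unfolding I_def by (rule card_lt_pairs)
  have P2: "2 * P = real (q * (q - 1))"
    using arg_cong[OF card_lt_pairs(1)[of q], of real] unfolding I_def P_def by simp
  have "0 < q * (q - 1)" using q(1) by simp
  then have Ppos: "P > 0" using P2 by (metis of_nat_0_less_iff mult_2 add_pos_pos linorder_not_less add_nonpos_nonpos)
  have fin\<Omega>: "finite \<Omega>" unfolding \<Omega>_def using fin by (intro finite_PiE) auto
  have finE: "finite E" using sub fin by (meson finite_SigmaI finite_subset)
  have finA: "finite (A x)" for x unfolding A_def using finI by auto
  have D_eq: "D x = g x ` A x" for x
  proof (rule set_eqI, rule iffI)
    fix b assume "b \<in> D x"
    then obtain i j where "b = f (x i) (x j)" "i < j" "j < q" "(x i, x j) \<in> E" unfolding D_def by blast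
    then show "b \<in> g x ` A x" unfolding g_def A_def I_def by (intro image_eqI[of _ _ "(i, j)"]) auto
  next
    fix b assume "b \<in> g x ` A x"
    then obtain p where "p \<in> I" "(x (fst p), x (snd p)) \<in> E" "b = f (x (fst p)) (x (snd p))"
      unfolding g_def A_def by blast
    moreover have "fst p < snd p" "snd p < q" using \<open>p \<in> I\<close> unfolding I_def by auto
    ultimately show "b \<in> D x" unfolding D_def by blast
  qed
  have D_le: "real (card (D x)) \<le> P" for x
  proof -
    have "card (D x) \<le> card (A x)" unfolding D_eq by (rule card_image_le[OF finA])
    also have "\<dots> \<le> card I" unfolding A_def by (rule card_mono[OF finI]) auto
    finally show ?thesis unfolding P_def by simp
  qed
  have D_ge: "real (card (D x)) \<ge> real (card (A x)) - real (card (B x))" for x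
    unfolding D_eq B_def by (rule card_image_ge_minus_collisions[OF finA])
  have one_pair: "(\<Sum>x\<in>\<Omega>. of_bool ((x i, x j) \<in> E)) = a" if "i < q" "j < q" "i \<noteq> j" for i j
  proof -
    have "(\<Sum>x\<in>\<Omega>. of_bool ((x i, x j) \<in> E)) = N ^ (q - 2) * (\<Sum>u\<in>S. \<Sum>v\<in>S. of_bool ((u, v) \<in> E))"
      unfolding \<Omega>_def N_def using that by (subst sum_PiE_two_coordinates) auto
    also have "(\<Sum>u\<in>S. \<Sum>v\<in>S. of_bool ((u, v) \<in> E)) = (\<Sum>p\<in>S \<times> S. of_bool (p \<in> E) :: real)"
      by (simp add: sum.cartesian_product)
    also have "\<dots> = real (card ((S \<times> S) \<inter> E))"
      using fin by (simp add: of_bool_def sum.If_cases Int_def)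
    also have "(S \<times> S) \<inter> E = E" using sub by auto
    finally show ?thesis unfolding a_def .
  qed
  \<comment> \<open>Fix all coordinates except \<open>l\<close>. The colour of the pair
    \<open>(i, j)\<close> is then determined, and \<open>deg\<close> at the vertex with index
    \<open>m\<close> leaves at most a fraction \<open>1 / 2 ^ c\<close> of \<open>S\<close> for the
    vertex with index \<open>l\<close>.\<close>
  have resample: "(\<Sum>x\<in>\<Omega>. of_bool ((x i, x j) \<in> E \<and> (x m, x l) \<in> E \<and> f (x i) (x j) = f (x m) (x l))) \<le> a / 2 ^ c"
    if h: "i < q" "j < q" "i \<noteq> j" "m < q" "l < q" "l \<noteq> i" "l \<noteq> j" "l \<noteq> m" for i j m l
  proof -
    let ?\<Omega>' = "PiE ({..<q} - {l}) (\<lambda>_. S)"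
    have "(\<Sum>x\<in>\<Omega>. of_bool ((x i, x j) \<in> E \<and> (x m, x l) \<in> E \<and> f (x i) (x j) = f (x m) (x l)))
      = (\<Sum>g\<in>?\<Omega>'. \<Sum>y\<in>S. of_bool ((g i, g j) \<in> E \<and> (g m, y) \<in> E \<and> f (g i) (g j) = f (g m) y) :: real)"
      unfolding \<Omega>_def using h by (subst sum_PiE_split[of _ l]) auto
    also have "\<dots> \<le> (\<Sum>g\<in>?\<Omega>'. of_bool ((g i, g j) \<in> E) * (N / 2 ^ c))"
    proof (rule sum_mono)
      fix g assume g: "g \<in> ?\<Omega>'"
      have "g m \<in> S" using g h by (auto simp: PiE_iff)
      from deg[OF this, of "f (g i) (g j)"]
      have d: "real (card {y \<in> S. (g m, y) \<in> E \<and> f (g m) y = f (g i) (g j)}) \<le> N / 2 ^ c"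
        by (simp add: N_def field_simps)
      have "(\<Sum>y\<in>S. of_bool ((g i, g j) \<in> E \<and> (g m, y) \<in> E \<and> f (g i) (g j) = f (g m) y) :: real)
        = of_bool ((g i, g j) \<in> E) * (\<Sum>y\<in>S. of_bool ((g m, y) \<in> E \<and> f (g m) y = f (g i) (g j)))"
        by (auto simp: sum_distrib_left intro!: sum.cong)
      also have "(\<Sum>y\<in>S. of_bool ((g m, y) \<in> E \<and> f (g m) y = f (g i) (g j))) =
         real (card {y \<in> S. (g m, y) \<in> E \<and> f (g m) y = f (g i) (g j)})"
        using fin by (simp add: of_bool_def sum.If_cases Int_def)
      also have "of_bool ((g i, g j) \<in> E) * \<dots> \<le> of_bool ((g i, g j) \<in> E) * (N / 2 ^ c)"
        using d by (intro mult_left_mono) auto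
      finally show "(\<Sum>y\<in>S. of_bool ((g i, g j) \<in> E \<and> (g m, y) \<in> E \<and> f (g i) (g j) = f (g m) y) :: real)
        \<le> of_bool ((g i, g j) \<in> E) * (N / 2 ^ c)" .
    qed
    also have "\<dots> = (\<Sum>g\<in>?\<Omega>'. \<Sum>y\<in>S. of_bool ((g i, g j) \<in> E)) / 2 ^ c"
      by (simp add: N_def sum_divide_distrib mult.commute)
    also have "(\<Sum>g\<in>?\<Omega>'. \<Sum>y\<in>S. of_bool ((g i, g j) \<in> E)) = (\<Sum>x\<in>\<Omega>. of_bool ((x i, x j) \<in> E) :: real)"
      unfolding \<Omega>_def using h by (subst sum_PiE_split[of _ l]) auto
    also have "\<dots> = a" using h by (intro one_pair) auto
    finally show ?thesis .
  qed
  have sumA: "(\<Sum>x\<in>\<Omega>. real (card (A x))) = P * a"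
  proof -
    have "real (card (A x)) = (\<Sum>p\<in>I. of_bool ((x (fst p), x (snd p)) \<in> E))" for x
      unfolding A_def using finI by (simp add: of_bool_def sum.If_cases Int_def)
    then have "(\<Sum>x\<in>\<Omega>. real (card (A x))) = (\<Sum>p\<in>I. \<Sum>x\<in>\<Omega>. of_bool ((x (fst p), x (snd p)) \<in> E))"
      by (simp add: sum.swap[of _ I])
    also have "\<dots> = (\<Sum>p\<in>I. a)"
      by (intro sum.cong refl one_pair) (auto simp: I_def)
    finally show ?thesis by (simp add: P_def)
  qed
  have coll: "(\<Sum>x\<in>\<Omega>. of_bool (p \<in> A x \<and> p' \<in> A x \<and> p \<noteq> p' \<and> g x p = g x p')) \<le> a / 2 ^ c"
    if p: "p \<in> I" "p' \<in> I" "p \<noteq> p'" for p p'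
  proof -
    obtain i j m l where e: "p = (i, j)" "p' = (m, l)" by (cases p, cases p') auto
    have h: "i < j" "j < q" "m < l" "l < q" "i \<noteq> m \<or> j \<noteq> l" using p unfolding e I_def by auto
    have "(\<Sum>x\<in>\<Omega>. of_bool (p \<in> A x \<and> p' \<in> A x \<and> p \<noteq> p' \<and> g x p = g x p'))
      = (\<Sum>x\<in>\<Omega>. of_bool ((x i, x j) \<in> E \<and> (x m, x l) \<in> E \<and> f (x i) (x j) = f (x m) (x l)) :: real)"
      using p unfolding A_def g_def e by (intro sum.cong) auto
    moreover have "(\<Sum>x\<in>\<Omega>. of_bool ((x i, x j) \<in> E \<and> (x m, x l) \<in> E \<and> f (x i) (x j) = f (x m) (x l)))
      = (\<Sum>x\<in>\<Omega>. of_bool ((x i, x j) \<in> E \<and> (x l, x m) \<in> E \<and> f (x i) (x j) = f (x l) (x m)) :: real)"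
    proof (rule sum.cong)
      fix x assume "x \<in> \<Omega>"
      have "(x m, x l) \<in> E \<longleftrightarrow> (x l, x m) \<in> E" using symE by (meson symD)
      then show "of_bool ((x i, x j) \<in> E \<and> (x m, x l) \<in> E \<and> f (x i) (x j) = f (x m) (x l))
        = (of_bool ((x i, x j) \<in> E \<and> (x l, x m) \<in> E \<and> f (x i) (x j) = f (x l) (x m)) :: real)"
        using symf[of "x m" "x l"] by simp
    qed simp
    \<comment> \<open>Two distinct index pairs share at most one index, so the second has an end
      outside the first. Symmetry allows either end to be the one that is resampled.\<close>
    moreover have "l \<noteq> i \<and> l \<noteq> j \<or> m \<noteq> i \<and> m \<noteq> j" using h by auto
    ultimately show ?thesis
      using resample[of i j m l] resample[of i j l m] h by (metis less_irrefl order.strict_trans)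
  qed
  have a0: "a \<ge> 0" unfolding a_def N_def by simp
  have sumB: "(\<Sum>x\<in>\<Omega>. real (card (B x))) \<le> P * a / 2"
  proof -
    let ?I2 = "{pp \<in> I \<times> I. fst pp \<noteq> snd pp}"
    have finI2: "finite ?I2" using finI by auto
    have "real (card (B x)) = (\<Sum>pp\<in>?I2. of_bool (fst pp \<in> A x \<and> snd pp \<in> A x \<and> fst pp \<noteq> snd pp \<and> g x (fst pp) = g x (snd pp)))" for x
    proof -
      have "B x = {pp \<in> ?I2. fst pp \<in> A x \<and> snd pp \<in> A x \<and> fst pp \<noteq> snd pp \<and> g x (fst pp) = g x (snd pp)}"
        unfolding B_def A_def by auto
      then show ?thesis using finI2 by (simp add: of_bool_def sum.If_cases Int_def) (rule arg_cong[where f = card], blast)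
    qed
    then have "(\<Sum>x\<in>\<Omega>. real (card (B x))) = (\<Sum>pp\<in>?I2. \<Sum>x\<in>\<Omega>. of_bool (fst pp \<in> A x \<and> snd pp \<in> A x \<and> fst pp \<noteq> snd pp \<and> g x (fst pp) = g x (snd pp)))"
      by (simp add: sum.swap[of _ ?I2])
    also have "\<dots> \<le> (\<Sum>pp\<in>?I2. a / 2 ^ c)"
      by (rule sum_mono, rule coll) auto
    also have "\<dots> = real (card ?I2) * (a / 2 ^ c)" by simp
    also have "\<dots> \<le> (P * P) * (a / 2 ^ c)"
    proof (rule mult_right_mono)
      have "card ?I2 \<le> card (I \<times> I)" using finI by (intro card_mono) auto
      then have "real (card ?I2) \<le> real (card (I \<times> I))" by (rule of_nat_mono)
      then show "real (card ?I2) \<le> P * P" by (simp add: P_def card_cartesian_product)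
    qed (use a0 in simp)
    also have "\<dots> = P * a * (P / 2 ^ c)" by simp
    also have "\<dots> \<le> P * a * (1 / 2)"
    proof (rule mult_left_mono)
      have "real (q * (q - 1)) \<le> real (2 ^ c)" using q(2) by (rule of_nat_mono)
      then show "P / 2 ^ c \<le> 1 / 2" using P2 by (simp add: field_simps)
    qed (use a0 Ppos in simp)
    finally show ?thesis by simp
  qed
  have aN: "a \<ge> \<mu> * N ^ q"
  proof -
    have "N ^ q = N ^ (q - 2) * N ^ 2" using q(1) by (metis power_add le_add_diff_inverse2)
    then have "\<mu> * N ^ q = N ^ (q - 2) * (\<mu> * N ^ 2)" by (simp only: mult.left_commute)
    also have "\<dots> \<le> a" unfolding a_def using mass by (intro mult_left_mono) (auto simp: N_def)
    finally show ?thesis .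
  qed
  define Gd where "Gd = {x \<in> \<Omega>. \<mu> * real (q * (q - 1)) / 8 \<le> real (card (D x))}"
  have "P * (\<mu> * N ^ q) / 2 \<le> P * a / 2" using aN Ppos by simp
  also have "\<dots> \<le> (\<Sum>x\<in>\<Omega>. real (card (A x)) - real (card (B x)))"
    using sumA sumB by (simp add: sum_subtractf)
  also have "\<dots> \<le> (\<Sum>x\<in>\<Omega>. real (card (D x)))" by (intro sum_mono D_ge)
  \<comment> \<open>Tuples in \<open>Gd\<close> contribute at most \<open>P\<close> each, the others
    less than \<open>\<mu> * P / 4\<close>, which is half of the mean already guaranteed. For
    negative \<open>\<mu>\<close> the claim is trivial and is treated separately.\<close>
  also have "\<dots> \<le> (\<Sum>x\<in>\<Omega>. of_bool (x \<in> Gd) * P + \<mu> * P / 4)" if "\<mu> \<ge> 0"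
  proof (rule sum_mono)
    fix x assume x: "x \<in> \<Omega>"
    show "real (card (D x)) \<le> of_bool (x \<in> Gd) * P + \<mu> * P / 4"
    proof (cases "x \<in> Gd")
      case True
      have "0 \<le> \<mu> * P" using that Ppos by simp
      then show ?thesis using True D_le[of x] by simp
    next
      case False
      then have "\<not> \<mu> * real (q * (q - 1)) / 8 \<le> real (card (D x))"
        using x unfolding Gd_def by blast
      then have "real (card (D x)) < \<mu> * real (q * (q - 1)) / 8" by (rule not_le_imp_less)
      then show ?thesis using False unfolding P2[symmetric] by (simp add: mult.commute)
    qed
  qed
  also have "(\<Sum>x\<in>\<Omega>. of_bool (x \<in> Gd) * P + \<mu> * P / 4) = P * real (card Gd) + real (card \<Omega>) * (\<mu> * P / 4)"
  proof -
    have "Gd \<subseteq> \<Omega>" unfolding Gd_def by auto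
    then have "(\<Sum>x\<in>\<Omega>. of_bool (x \<in> Gd)) = real (card Gd)"
      using fin\<Omega> by (simp add: of_bool_def sum.If_cases Int_absorb1)
    then show ?thesis by (simp add: sum.distrib sum_distrib_right[symmetric])
  qed
  also have "real (card \<Omega>) = N ^ q" unfolding \<Omega>_def N_def by (simp add: card_PiE)
  finally have fin_ineq: "P * (\<mu> * N ^ q) / 2 \<le> P * real (card Gd) + N ^ q * (\<mu> * P / 4)" if "\<mu> \<ge> 0"
    using that by blast
  have "\<mu> / 4 * N ^ q \<le> real (card Gd)"
  proof (cases "\<mu> \<ge> 0")
    case True
    from fin_ineq[OF this] have "P * (\<mu> / 4 * N ^ q) \<le> P * real (card Gd)" by (simp add: algebra_simps)
    then show ?thesis using Ppos by simp
  next
    case False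
    then have "\<mu> / 4 * N ^ q \<le> 0" by (intro mult_nonpos_nonneg) (auto simp: N_def)
    then show ?thesis by (rule order_trans) simp
  qed
  then show ?thesis unfolding Gd_def D_def N_def \<Omega>_def .
qed

section \<open>Estimates\<close>

definition lg :: "'a set \<Rightarrow> real" where
  "lg Z = log 2 (real (card Z))"

lemma power4_le_exp2: "16 \<le> n \<Longrightarrow> n ^ 4 \<le> (2::nat) ^ n"
proof (induction n rule: dec_induct)
  case (step n)
  have "(Suc n) ^ 4 = n ^ 4 + 4 * n ^ 3 + 6 * n ^ 2 + 4 * n + 1"
    by (simp add: eval_nat_numeral algebra_simps)
  moreover have "16 * n ^ 3 \<le> n * n ^ 3" "16 * n ^ 2 \<le> n * n ^ 2" "16 * n \<le> n * n"
    using step(1) by (simp_all only: mult_right_mono zero_le)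
  moreover have "n * n ^ 3 = n ^ 4" "n * n ^ 2 = n ^ 3" "n * n = n ^ 2"
    by (simp_all add: power4_eq_xxxx power3_eq_cube power2_eq_square)
  ultimately have "(Suc n) ^ 4 \<le> 2 * n ^ 4" using step(1) by linarith
  then show ?case using step(3) by simp
qed simp

text \<open>The second hypothesis is polynomial in \<open>2 ^ j\<close>, hence in \<open>l\<close>:
  it gives \<open>F \<le> l ^ 2\<close>, and \<open>16 * 2 ^ j \<le> l ^ 2\<close>, while
  \<open>l ^ 4 \<le> 2 ^ l\<close>. In the application, \<open>F\<close> colours of frequency at
  most \<open>1 / 2 ^ l\<close> each cover at most a fraction \<open>1 / 2 ^ (j + 4)\<close> of all
  pairs.\<close>

lemma excluded_colours_bound:
  fixes F :: real
  assumes l: "2 ^ (5 + j) \<le> (l::nat)"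
    and F: "512 * F \<le> 3 / 2 * (2 ^ (11 + 2 * j) + real l + 2 + 2 ^ (6 + j) + 2)"
  shows "F * 2 ^ (j + 4) \<le> 2 ^ l"
proof -
  define t where "t = (2::real) ^ j"
  have t1: "1 \<le> t" unfolding t_def by simp
  have "real (2 ^ (5 + j)) \<le> real l" using l by (rule of_nat_mono)
  then have tl: "32 * t \<le> real l" unfolding t_def by (simp add: power_add)
  have p: "(2::real) ^ (11 + 2 * j) = 2048 * t\<^sup>2" "(2::real) ^ (6 + j) = 64 * t" "(2::real) ^ (j + 4) = 16 * t"
    unfolding t_def by (simp_all add: power_add power_mult power2_eq_square power_mult_distrib[symmetric])
  have L: "32 \<le> real l" using t1 tl by linarith
  have "16 \<le> l" using L by linarith
  then have "real (l ^ 4) \<le> real (2 ^ l)" by (intro of_nat_mono power4_le_exp2)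
  then have l4: "real l ^ 4 \<le> 2 ^ l" by simp
  have "2048 * t\<^sup>2 \<le> 2 * (real l)\<^sup>2"
    using power_mono[OF tl, of 2] t1 by (simp add: power_mult_distrib)
  then have "512 * F \<le> 3 / 2 * (2 * (real l)\<^sup>2 + 3 * real l + 4)" using F tl unfolding p by argo
  moreover have "3 * real l + 4 \<le> 4 * (real l)\<^sup>2"
    unfolding power2_eq_square using mult_right_mono[OF L, of "real l"] L by linarith
  moreover have "0 \<le> (real l)\<^sup>2" by simp
  ultimately have "F \<le> (real l)\<^sup>2" by argo
  then have "F * (16 * t) \<le> (real l)\<^sup>2 * (16 * t)" using t1 by (intro mult_right_mono) auto
  also have "\<dots> \<le> (real l)\<^sup>2 * (real l)\<^sup>2"
  proof (rule mult_left_mono)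
    have "real l * 1 \<le> real l * real l" using L by (intro mult_left_mono) auto
    then show "16 * t \<le> (real l)\<^sup>2" unfolding power2_eq_square using tl t1 by linarith
  qed simp
  also have "\<dots> \<le> 2 ^ l" using l4 by (simp add: eval_nat_numeral)
  finally show ?thesis unfolding p .
qed

lemma power2_floor_log:
  fixes x :: real assumes "1 \<le> x" obtains n :: nat where "2 ^ n \<le> x" "x < 2 ^ (n + 1)"
proof -
  define n where "n = nat \<lfloor>log 2 x\<rfloor>"
  have "real n = real_of_int \<lfloor>log 2 x\<rfloor>" unfolding n_def using assms by simp
  then have n: "real n \<le> log 2 x" "log 2 x < real (n + 1)" by linarith+
  have "2 powr real n \<le> x" using n(1) assms by (simp add: le_log_iff)
  then have "2 ^ n \<le> x" by (simp add: powr_realpow)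
  moreover have "x < 2 powr real (n + 1)" using n(2) assms by (subst (asm) log_less_iff) auto
  then have "x < 2 ^ (n + 1)" by (subst (asm) powr_realpow) auto
  ultimately show ?thesis by (rule that)
qed

lemma finite_obtain_max:
  fixes f :: "'a \<Rightarrow> real"
  assumes "finite A" "A \<noteq> {}"
  obtains x where "x \<in> A" "\<And>y. y \<in> A \<Longrightarrow> f y \<le> f x"
proof -
  have "Max (f ` A) \<in> f ` A" using assms by (intro Max_in) auto
  then obtain x where "x \<in> A" "f x = Max (f ` A)" by auto
  then show ?thesis using that[of x] assms by (metis Max_ge finite_imageI imageI)
qed

lemma lg_le_add:
  assumes "finite A" "A \<noteq> {}" "finite B" "card A \<le> card B * 2 ^ m"
  shows "lg A - lg B \<le> real m"
proof -
  have A: "0 < card A" using assms by (simp add: card_gt_0_iff)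
  then have B: "0 < card B" using assms(4) by (cases "card B") auto
  have "real (card A) \<le> real (card B * 2 ^ m)" using assms(4) by (rule of_nat_mono)
  then have "lg A \<le> log 2 (real (card B) * 2 ^ m)"
    unfolding lg_def using A B by (subst log_le_cancel_iff) auto
  also have "\<dots> = lg B + log 2 (2 ^ m)" unfolding lg_def using B by (subst log_mult) auto
  also have "log 2 (2 ^ m) = real m" by (subst log_nat_power) auto
  finally show ?thesis by simp
qed

lemma card_ge_of_lg:
  assumes "finite A" "A \<noteq> {}" "finite B" "B \<noteq> {}" "lg A - lg B \<le> r"
  shows "real (card A) * 2 powr (- r) \<le> real (card B)"
proof -
  have pos: "0 < real (card A)" "0 < real (card B)" using assms by (simp_all add: card_gt_0_iff)
  have "real (card A) * 2 powr (- r) = 2 powr (lg A - r)"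
    unfolding lg_def using pos by (simp add: powr_diff powr_minus divide_inverse)
  also have "\<dots> \<le> 2 powr (lg B)" using assms(5) by simp
  also have "\<dots> = real (card B)" unfolding lg_def using pos by simp
  finally show ?thesis .
qed

section \<open>The potential\<close>

text \<open>Both configurations are copies of \<open>K4\<close> with at most two colours: in
  \<open>no_bip\<close> a four-cycle of colour \<open>b\<close> whose diagonals share a colour, in
  \<open>no_star\<close> five edges of colour \<open>b\<close> and an arbitrary sixth one.\<close>

locale no_two_coloured_K4 =
  fixes col :: "'v::linorder \<Rightarrow> 'v \<Rightarrow> 'c" and V :: "'v set" and K :: nat
  assumes finV: "finite V"
    and col_sym: "col x y = col y x"
    and no_bip: "\<lbrakk>w \<in> V; w' \<in> V; x \<in> V; x' \<in> V; distinct [w, w', x, x'];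
      col w x = b; col w x' = b; col w' x = b; col w' x' = b\<rbrakk> \<Longrightarrow> col w w' \<noteq> col x x'"
    and no_star: "\<lbrakk>v \<in> V; x \<in> V; y \<in> V; z \<in> V; distinct [v, x, y, z];
      col v x = b; col v y = b; col v z = b; col x y = b\<rbrakk> \<Longrightarrow> col x z \<noteq> b"
    and palette: "card {col x y | x y. x \<in> V \<and> y \<in> V \<and> x \<noteq> y} \<le> 2 ^ K"
begin

definition cols :: "'v set \<Rightarrow> 'c set" where
  "cols Z = {col x y | x y. x \<in> Z \<and> y \<in> Z \<and> x \<noteq> y}"

definition nbrs :: "'v set \<Rightarrow> 'v \<Rightarrow> 'c \<Rightarrow> 'v set" where
  "nbrs Z x b = {y \<in> Z. y \<noteq> x \<and> col x y = b}"

text \<open>Ordered pairs, with the degree condition imposed at both ends, so that the relation is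
  symmetric.\<close>

definition thin :: "'v set \<Rightarrow> nat \<Rightarrow> ('v \<times> 'v) set" where
  "thin Z c = {(x, y). x \<in> Z \<and> y \<in> Z \<and> x \<noteq> y \<and>
     card (nbrs Z x (col x y)) * 2 ^ c \<le> card Z \<and> card (nbrs Z y (col x y)) * 2 ^ c \<le> card Z}"

text \<open>
  The scale \<open>c = 2\<^sup>5\<^sup>+\<^sup>j\<close> is indexed by \<open>j\<close>. The required density \<open>2\<^sup>-\<^sup>j\<^sup>-\<^sup>1\<close> of thin pairs is halved from one
  scale to the next: a set that is rich at scale \<open>j\<close> but not at \<open>j + 1\<close> therefore has many pairs
  strictly between the two scales.
\<close>

definition rich :: "nat \<Rightarrow> 'v set \<Rightarrow> bool" where
  "rich j Z \<longleftrightarrow> (card Z)\<^sup>2 \<le> 2 ^ (j + 1) * card (thin Z (2 ^ (5 + j)))"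

text \<open>
  Richness is inherited from subsets with a penalty linear in the logarithm of the density, so that
  it is almost monotone and almost constant on the dense subsets of a maximiser of the potential.
\<close>

definition richness :: "nat \<Rightarrow> 'v set \<Rightarrow> real" where
  "richness j Z = Max (insert 0
     ((\<lambda>Z'. 2 ^ (5 + j) - (lg Z - lg Z') / 2 ^ (6 + j)) ` {Z'. Z' \<subseteq> Z \<and> Z' \<noteq> {} \<and> rich j Z'}))"

text \<open>A large value means many vertices for few colours and little richness. Losing one colour
  is worth a factor \<open>2 ^ 1024\<close> in size. The weight 16 is fitted to the slopes
  \<open>1 / 2 ^ (6 + j)\<close>, whose sum is at most \<open>1 / 32\<close>: on passing to a subset
  the richness term grows by at most half of the loss in \<open>lg\<close>.\<close>

definition potential :: "'v set \<Rightarrow> real" where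
  "potential Z = lg Z - 1024 * real (card (cols Z)) - 16 * (\<Sum>j\<le>K. richness j Z)"

definition maximal :: "'v set \<Rightarrow> bool" where
  "maximal Z \<longleftrightarrow> (\<forall>Z'. Z' \<subseteq> Z \<longrightarrow> Z' \<noteq> {} \<longrightarrow> potential Z' \<le> potential Z)"

text \<open>This is the only consequence of maximality that a trap records: each lost colour costs
  at least \<open>2048 / 3\<close> in \<open>lg\<close>.\<close>

definition inefficient :: "'v set \<Rightarrow> bool" where
  "inefficient Z \<longleftrightarrow> (\<forall>W. W \<subseteq> Z \<longrightarrow> W \<noteq> {} \<longrightarrow>
     1024 * (real (card (cols Z)) - real (card (cols W))) \<le> 3 / 2 * (lg Z - lg W))"

section \<open>Behaviour of richness and potential on subsets\<close>

lemma lg_mono: "Z' \<subseteq> Z \<Longrightarrow> Z' \<noteq> {} \<Longrightarrow> finite Z \<Longrightarrow> lg Z' \<le> lg Z"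
  unfolding lg_def by (subst log_le_cancel_iff) (auto simp: card_gt_0_iff card_mono finite_subset)

lemma finite_cols: "finite Z \<Longrightarrow> finite (cols Z)"
proof -
  assume "finite Z"
  then have "finite ((\<lambda>(x, y). col x y) ` (Z \<times> Z))" by auto
  then show ?thesis by (rule finite_subset[rotated]) (auto simp: cols_def)
qed

lemma cols_mono: "Z' \<subseteq> Z \<Longrightarrow> cols Z' \<subseteq> cols Z"
  unfolding cols_def by blast

lemma card_cols_mono: "Z' \<subseteq> Z \<Longrightarrow> finite Z \<Longrightarrow> card (cols Z') \<le> card (cols Z)"
  by (intro card_mono finite_cols cols_mono)

lemma richness_nonneg: "finite Z \<Longrightarrow> 0 \<le> richness j Z"
  unfolding richness_def by (intro Max_ge) (auto intro!: finite_imageI)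

lemma richness_ge:
  assumes "finite Z" "Z' \<subseteq> Z" "Z' \<noteq> {}" "rich j Z'"
  shows "2 ^ (5 + j) - (lg Z - lg Z') / 2 ^ (6 + j) \<le> richness j Z"
  unfolding richness_def using assms by (intro Max_ge) (auto intro!: finite_imageI)

lemma richness_pos:
  assumes "finite Z" "0 < richness j Z"
  obtains Z' where "Z' \<subseteq> Z" "Z' \<noteq> {}" "rich j Z'"
    "richness j Z = 2 ^ (5 + j) - (lg Z - lg Z') / 2 ^ (6 + j)"
proof -
  have "richness j Z \<in> insert 0
     ((\<lambda>Z'. 2 ^ (5 + j) - (lg Z - lg Z') / 2 ^ (6 + j)) ` {Z'. Z' \<subseteq> Z \<and> Z' \<noteq> {} \<and> rich j Z'})"
    unfolding richness_def using assms by (intro Max_in) (auto intro!: finite_imageI)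
  then show ?thesis using assms that by auto
qed

lemma richness_le:
  assumes "finite Z" shows "richness j Z \<le> 2 ^ (5 + j)"
proof (cases "0 < richness j Z")
  case True
  from richness_pos[OF assms this] obtain Z' where Z': "Z' \<subseteq> Z" "Z' \<noteq> {}"
    "richness j Z = 2 ^ (5 + j) - (lg Z - lg Z') / 2 ^ (6 + j)" by metis
  have "0 \<le> (lg Z - lg Z') / 2 ^ (6 + j)" using lg_mono[OF Z'(1,2) assms] by simp
  then show ?thesis using Z'(3) by linarith
next
  case False
  have "(0::real) \<le> 2 ^ (5 + j)" by simp
  then show ?thesis using False by linarith
qed

text \<open>A rich subset of \<open>Z'\<close> is also a rich subset of \<open>Z\<close>; only its
  penalty grows, by the slope times \<open>lg Z - lg Z'\<close>.\<close>

lemma richness_subset: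
  assumes "finite Z" "Z' \<subseteq> Z" "Z' \<noteq> {}"
  shows "richness j Z' \<le> richness j Z + (lg Z - lg Z') / 2 ^ (6 + j)"
proof (cases "0 < richness j Z'")
  case True
  have "finite Z'" using assms finite_subset by blast
  from richness_pos[OF this True] obtain Y where Y: "Y \<subseteq> Z'" "Y \<noteq> {}" "rich j Y"
    "richness j Z' = 2 ^ (5 + j) - (lg Z' - lg Y) / 2 ^ (6 + j)" by metis
  have "2 ^ (5 + j) - (lg Z - lg Y) / 2 ^ (6 + j) \<le> richness j Z"
    using Y assms by (intro richness_ge) auto
  then show ?thesis using Y(4) by (simp add: diff_divide_distrib)
next
  case False
  have "0 \<le> (lg Z - lg Z') / 2 ^ (6 + j)" using lg_mono[OF assms(2,3,1)] by simp
  then show ?thesis using False richness_nonneg[OF assms(1), of j] by linarith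
qed

lemma sum_eta: "(\<Sum>j\<le>n. (1::real) / 2 ^ (6 + j)) \<le> 1 / 32"
proof -
  have "(\<Sum>j\<le>n. (1::real) / 2 ^ (6 + j)) = 1 / 32 - 1 / 2 ^ (6 + n)"
    by (induction n) (simp_all add: power_add divide_simps)
  then show ?thesis by simp
qed

lemma sum_richness_subset:
  assumes "finite Z" "Z' \<subseteq> Z" "Z' \<noteq> {}" "S \<subseteq> {..K}"
  shows "(\<Sum>j\<in>S. richness j Z') \<le> (\<Sum>j\<in>S. richness j Z) + (lg Z - lg Z') / 32"
proof -
  have d: "0 \<le> lg Z - lg Z'" using lg_mono[OF assms(2,3,1)] by simp
  have finS: "finite S" using assms(4) finite_subset by blast
  have "(\<Sum>j\<in>S. richness j Z') \<le> (\<Sum>j\<in>S. richness j Z + (lg Z - lg Z') / 2 ^ (6 + j))"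
    by (intro sum_mono richness_subset assms)
  also have "\<dots> = (\<Sum>j\<in>S. richness j Z) + (lg Z - lg Z') * (\<Sum>j\<in>S. 1 / 2 ^ (6 + j))"
    by (simp add: sum.distrib sum_distrib_left)
  also have "(\<Sum>j\<in>S. (1::real) / 2 ^ (6 + j)) \<le> 1 / 32"
    using sum_mono2[of "{..K}" S "\<lambda>j. (1::real) / 2 ^ (6 + j)"] sum_eta[of K] assms(4) by auto
  finally show ?thesis using d by (simp add: mult_left_mono)
qed

lemma potential_subset:
  assumes "finite Z" "Z' \<subseteq> Z" "Z' \<noteq> {}"
  shows "potential Z - 3 / 2 * (lg Z - lg Z') \<le> potential Z'"
  using sum_richness_subset[OF assms subset_refl] card_cols_mono[OF assms(2,1)]
  unfolding potential_def by (simp add: field_simps)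

text \<open>The gain from lost colours must be offset by the loss in \<open>lg\<close> together with
  the growth of the richness term, which is at most half of that loss.\<close>

lemma maximal_inefficient:
  assumes "finite Z" "maximal Z"
  shows "inefficient Z"
  unfolding inefficient_def
proof (intro allI impI)
  fix W assume W: "W \<subseteq> Z" "W \<noteq> {}"
  then have "potential W \<le> potential Z" using assms unfolding maximal_def by blast
  then show "1024 * (real (card (cols Z)) - real (card (cols W))) \<le> 3 / 2 * (lg Z - lg W)"
    using sum_richness_subset[OF assms(1) W subset_refl] unfolding potential_def by (simp add: field_simps)
qed

text \<open>With \<open>d = lg Z - lg Z'\<close>, maximality lets the total richness fall by at most
  \<open>d / 16\<close>. The other scales can rise by at most \<open>d / 32\<close> together, so
  scale \<open>j\<close> alone falls by at most \<open>3 / 32 * d\<close>.\<close>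

lemma maximal_richness:
  assumes "finite Z" "maximal Z" "Z' \<subseteq> Z" "Z' \<noteq> {}" "j \<le> K"
  shows "richness j Z - 3 / 32 * (lg Z - lg Z') \<le> richness j Z'"
proof -
  have "potential Z' \<le> potential Z" using assms unfolding maximal_def by blast
  then have "16 * ((\<Sum>j\<le>K. richness j Z) - (\<Sum>j\<le>K. richness j Z')) \<le> lg Z - lg Z'"
    using card_cols_mono[OF assms(3,1)] unfolding potential_def by (simp add: algebra_simps)
  moreover have "(\<Sum>i\<le>K. richness i Y) = richness j Y + (\<Sum>i\<in>{..K} - {j}. richness i Y)" for Y
    using assms(5) by (simp add: sum.remove[of _ j])
  ultimately show ?thesis
    using sum_richness_subset[OF assms(1,3,4), of "{..K} - {j}"] by (simp add: field_simps)
qed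

section \<open>Colour neighbourhoods, thin pairs and colour classes\<close>

text \<open>By \<open>no_star\<close>, colour \<open>b\<close> is a matching inside the
  neighbourhood. The set \<open>I\<close> keeps the unmatched vertices and the smaller end of each
  matching edge; the map to the partner injects the remaining vertices into
  \<open>I\<close>.\<close>

lemma nbrs_independent_half:
  assumes "v \<in> V" "Z \<subseteq> V"
  obtains I where "I \<subseteq> nbrs Z v b" "b \<notin> cols I" "card (nbrs Z v b) \<le> 2 * card I"
proof -
  define N where "N = nbrs Z v b"
  define I where "I = {x \<in> N. \<forall>y\<in>N. y \<noteq> x \<longrightarrow> col x y = b \<longrightarrow> x < y}"
  have finN: "finite N" unfolding N_def nbrs_def using finite_subset[OF assms(2) finV] by auto
  have unique: "y = z" if "x \<in> N" "y \<in> N" "z \<in> N" "y \<noteq> x" "z \<noteq> x" "col x y = b" "col x z = b" for x y z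
  proof (rule ccontr)
    assume "y \<noteq> z"
    then show False
      using no_star[of v x y z b] that assms unfolding N_def nbrs_def by auto
  qed
  have "\<forall>x\<in>N - I. \<exists>y. y \<in> N \<and> y \<noteq> x \<and> col x y = b \<and> y < x"
    unfolding I_def by (auto simp: not_less le_less)
  from bchoice[OF this] obtain h where
    h: "\<And>x. x \<in> N - I \<Longrightarrow> h x \<in> N \<and> h x \<noteq> x \<and> col x (h x) = b \<and> h x < x"
    by blast
  have "inj_on h (N - I)"
  proof (rule inj_onI)
    fix x x' assume "x \<in> N - I" "x' \<in> N - I" "h x = h x'"
    then show "x = x'"
      using h[of x] h[of x'] unique[of "h x" x x'] col_sym[of "h x" x] col_sym[of "h x" x'] by auto
  qed
  moreover have "h ` (N - I) \<subseteq> I"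
  proof
    fix y assume "y \<in> h ` (N - I)"
    then obtain x where x: "x \<in> N - I" "y = h x" by blast
    show "y \<in> I"
      unfolding I_def
    proof (intro CollectI conjI ballI impI)
      fix z assume z: "z \<in> N" "z \<noteq> y" "col y z = b"
      then have "z = x" using unique[of y z x] h[OF x(1)] x col_sym[of x y] by auto
      then show "y < z" using h[OF x(1)] x by simp
    qed (use h x in auto)
  qed
  moreover have "finite I" using finN unfolding I_def by auto
  ultimately have "card (N - I) \<le> card I" using card_inj_on_le by blast
  moreover have "card N = card I + card (N - I)"
    using card_Diff_subset[of I N] card_mono[of N I] \<open>finite I\<close> finN I_def by auto
  ultimately have "card N \<le> 2 * card I" by linarith
  moreover have "b \<notin> cols I"
  proof
    assume "b \<in> cols I"
    then obtain x y where "x \<in> I" "y \<in> I" "x \<noteq> y" "col x y = b" unfolding cols_def by blast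
    then show False using col_sym[of x y] unfolding I_def by force
  qed
  moreover have "I \<subseteq> N" unfolding I_def by auto
  ultimately show ?thesis using that[of I] unfolding N_def by blast
qed

lemma finite_thin: "finite Z \<Longrightarrow> finite (thin Z c)"
  by (rule finite_subset[of _ "Z \<times> Z"]) (auto simp: thin_def)

lemma sym_thin: "sym (thin Z c)"
  unfolding thin_def sym_def by (auto simp: col_sym)

text \<open>Otherwise fewer than half of all pairs are thin, while at most a third are diagonal, so
  some off-diagonal pair is not thin. It yields a vertex with a colour of degree above
  \<open>card Z / 2 ^ 32\<close>, hence a subset of logarithmic cost at most 33 that loses this
  colour. A lost colour weighs 1024, but maximality allows only \<open>3 / 2 * 33\<close>.\<close>

lemma maximal_rich_0:
  assumes "Z \<subseteq> V" "maximal Z" "3 \<le> card Z"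
  shows "rich 0 Z"
proof (rule ccontr)
  assume "\<not> rich 0 Z"
  then have nr: "2 * card (thin Z 32) < (card Z)\<^sup>2" by (simp add: rich_def)
  have finZ: "finite Z" using assms(3) card.infinite by fastforce
  define D where "D = {p \<in> Z \<times> Z. fst p \<noteq> snd p}"
  have "Z \<times> Z = D \<union> (\<lambda>x. (x, x)) ` Z" unfolding D_def by auto
  then have "card (Z \<times> Z) \<le> card D + card ((\<lambda>x. (x, x)) ` Z)" by (metis card_Un_le)
  also have "card ((\<lambda>x. (x, x)) ` Z) \<le> card Z" using finZ by (rule card_image_le)
  finally have "(card Z)\<^sup>2 \<le> card D + card Z" by (simp add: card_cartesian_product power2_eq_square)
  moreover have "3 * card Z \<le> (card Z)\<^sup>2" using assms(3) by (simp add: power2_eq_square)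
  ultimately have "card (thin Z 32) < card D" using nr assms(3) by linarith
  then have "\<not> D \<subseteq> thin Z 32" using finite_thin[OF finZ] card_mono by (metis linorder_not_le)
  then obtain p where p: "p \<in> D" "p \<notin> thin Z 32" by blast
  obtain x y where "p = (x, y)" by (cases p)
  with p have xy: "x \<in> Z" "y \<in> Z" "x \<noteq> y" "(x, y) \<notin> thin Z 32" unfolding D_def by auto
  define b where "b = col x y"
  have "\<exists>v\<in>Z. card Z < card (nbrs Z v b) * 2 ^ 32"
    using xy unfolding thin_def b_def by (auto simp: not_le)
  then obtain v where v: "v \<in> Z" "card Z < card (nbrs Z v b) * 2 ^ 32" by blast
  obtain I where I: "I \<subseteq> nbrs Z v b" "b \<notin> cols I" "card (nbrs Z v b) \<le> 2 * card I"
    using nbrs_independent_half[of v Z b] v assms(1) by blast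
  have IZ: "I \<subseteq> Z" using I(1) unfolding nbrs_def by auto
  have cI: "card Z < card I * 2 ^ 33" using v(2) I(3) by simp
  then have "I \<noteq> {}" by auto
  have "b \<in> cols Z" using xy unfolding cols_def b_def by blast
  then have "card (cols I) < card (cols Z)"
    using I(2) cols_mono[OF IZ] finite_cols[OF finZ] by (intro psubset_card_mono) auto
  then have "real (card (cols I)) + 1 \<le> real (card (cols Z))" by linarith
  moreover have "1024 * (real (card (cols Z)) - real (card (cols I))) \<le> 3 / 2 * (lg Z - lg I)"
    using maximal_inefficient[OF finZ assms(2)] IZ \<open>I \<noteq> {}\<close> unfolding inefficient_def by blast
  moreover have "lg Z \<le> lg I + 33"
  proof -
    have "card I > 0" using cI by auto
    have "real (card Z) \<le> real (card I) * 2 ^ 33" using cI by (simp add: of_nat_less_iff[symmetric, where 'a = real] del: of_nat_less_iff)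
    then have "lg Z \<le> log 2 (real (card I) * 2 ^ 33)"
      unfolding lg_def using assms(3) \<open>card I > 0\<close> by (subst log_le_cancel_iff) auto
    also have "\<dots> = lg I + log 2 (2 ^ 33)" unfolding lg_def using \<open>card I > 0\<close> by (subst log_mult) auto
    also have "log 2 (2 ^ 33) = (33::real)" by (subst log_nat_power) auto
    finally show ?thesis .
  qed
  ultimately show False by argo
qed

lemma thin_row:
  assumes "finite Z" "x \<in> Z"
  shows "card {y \<in> Z. (x, y) \<in> thin Z c \<and> col x y = b} * 2 ^ c \<le> card Z"
proof (cases "{y \<in> Z. (x, y) \<in> thin Z c \<and> col x y = b} = {}")
  case True
  then show ?thesis by (metis card.empty mult_zero_left le0)
next
  case False
  then have "card (nbrs Z x b) * 2 ^ c \<le> card Z" unfolding thin_def by auto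
  moreover have "card {y \<in> Z. (x, y) \<in> thin Z c \<and> col x y = b} \<le> card (nbrs Z x b)"
    using assms by (intro card_mono) (auto simp: nbrs_def thin_def)
  ultimately show ?thesis by (meson le_trans mult_le_mono1)
qed

lemma thin_colour_class:
  assumes "finite Z"
  shows "card {p \<in> thin Z c. col (fst p) (snd p) = b} * 2 ^ c \<le> (card Z)\<^sup>2"
proof -
  have "{p \<in> thin Z c. col (fst p) (snd p) = b} = (SIGMA x:Z. {y \<in> Z. (x, y) \<in> thin Z c \<and> col x y = b})"
    by (auto simp: thin_def)
  then have "card {p \<in> thin Z c. col (fst p) (snd p) = b} * 2 ^ c
    = (\<Sum>x\<in>Z. card {y \<in> Z. (x, y) \<in> thin Z c \<and> col x y = b} * 2 ^ c)"
    using assms by (simp add: sum_distrib_right)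
  also have "\<dots> \<le> (\<Sum>x\<in>Z. card Z)" by (intro sum_mono thin_row assms)
  finally show ?thesis by (simp add: power2_eq_square)
qed

lemma card_le_sum_colour_classes:
  assumes "finite Z" "E \<subseteq> thin Z c"
  shows "card E \<le> (\<Sum>b\<in>cols Z. card {p \<in> E. col (fst p) (snd p) = b})"
proof -
  have "E \<subseteq> (\<Union>b\<in>cols Z. {p \<in> E. col (fst p) (snd p) = b})"
    using assms(2) unfolding thin_def cols_def by fastforce
  moreover have "finite E" using assms finite_thin finite_subset by blast
  ultimately have "card E \<le> card (\<Union>b\<in>cols Z. {p \<in> E. col (fst p) (snd p) = b})"
    by (intro card_mono) (auto simp: finite_cols assms)
  also have "\<dots> \<le> (\<Sum>b\<in>cols Z. card {p \<in> E. col (fst p) (snd p) = b})"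
    by (rule card_UN_le) (simp add: finite_cols assms)
  finally show ?thesis .
qed

lemma card_cols_le: "Z \<subseteq> V \<Longrightarrow> card (cols Z) \<le> 2 ^ K"
  using card_cols_mono[of Z V] finV palette unfolding cols_def by force

text \<open>Each of the at most \<open>2 ^ K\<close> colours covers at most a fraction
  \<open>1 / 2 ^ c\<close> of all pairs by thin ones, with \<open>c = 2 ^ (5 + j)\<close>, whereas
  richness demands a fraction \<open>1 / 2 ^ (j + 1)\<close>.\<close>

lemma rich_bound:
  assumes "Z \<subseteq> V" "Z \<noteq> {}" "rich j Z"
  shows "2 ^ (5 + j) \<le> K + j + 1"
proof -
  let ?c = "2 ^ (5 + j) :: nat"
  have finZ: "finite Z" using assms finV finite_subset by blast
  have "card (thin Z ?c) * 2 ^ ?c \<le> (\<Sum>b\<in>cols Z. card {p \<in> thin Z ?c. col (fst p) (snd p) = b}) * 2 ^ ?c"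
    by (intro mult_right_mono card_le_sum_colour_classes[OF finZ subset_refl]) simp
  also have "\<dots> = (\<Sum>b\<in>cols Z. card {p \<in> thin Z ?c. col (fst p) (snd p) = b} * 2 ^ ?c)"
    by (simp add: sum_distrib_right)
  also have "\<dots> \<le> (\<Sum>b\<in>cols Z. (card Z)\<^sup>2)"
    by (intro sum_mono thin_colour_class finZ)
  also have "\<dots> \<le> 2 ^ K * (card Z)\<^sup>2" using card_cols_le[OF assms(1)] by simp
  finally have t: "card (thin Z ?c) * 2 ^ ?c \<le> 2 ^ K * (card Z)\<^sup>2" .
  have "(card Z)\<^sup>2 * 2 ^ ?c \<le> 2 ^ (j + 1) * (card (thin Z ?c) * 2 ^ ?c)"
    using assms(3) unfolding rich_def by (metis mult.assoc mult_le_mono1)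
  also have "\<dots> \<le> 2 ^ (j + 1) * (2 ^ K * (card Z)\<^sup>2)" using t by (rule mult_le_mono2)
  also have "\<dots> = (card Z)\<^sup>2 * 2 ^ (K + j + 1)" by (simp add: power_add algebra_simps)
  finally have "(2::nat) ^ ?c \<le> 2 ^ (K + j + 1)" using assms(2) finZ by (simp add: card_gt_0_iff)
  then show ?thesis by (rule power_le_imp_le_exp[rotated]) simp
qed

section \<open>Traps\<close>

lemma sum_card_nbrs_swap:
  assumes "finite A" "finite B"
  shows "(\<Sum>a\<in>A. card (nbrs B a b)) = (\<Sum>y\<in>B. card (nbrs A y b))"
proof -
  have "(\<Sum>a\<in>A. card (nbrs B a b)) = card (SIGMA a:A. nbrs B a b)"
    using assms by (subst card_SigmaI) (auto simp: nbrs_def)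
  also have "(SIGMA a:A. nbrs B a b) = prod.swap ` (SIGMA y:B. nbrs A y b)"
    by (auto simp: nbrs_def image_iff col_sym)
  also have "card \<dots> = card (SIGMA y:B. nbrs A y b)"
    by (intro card_image) auto
  also have "\<dots> = (\<Sum>y\<in>B. card (nbrs A y b))"
    using assms by (subst card_SigmaI) (auto simp: nbrs_def)
  finally show ?thesis .
qed

text \<open>Double counting of the edges of colour \<open>b\<close>: they have density at least
  \<open>1 / 2 ^ m\<close>, and the unpopular vertices of \<open>B\<close> account for at most half
  of that.\<close>

lemma many_popular_vertices:
  assumes "finite A" "finite B" "A \<noteq> {}" "\<And>a. a \<in> A \<Longrightarrow> card B \<le> card (nbrs B a b) * 2 ^ m"
  shows "card B \<le> card {y \<in> B. card A \<le> card (nbrs A y b) * 2 ^ (m + 1)} * 2 ^ (m + 1)"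
proof -
  let ?P = "{y \<in> B. card A \<le> card (nbrs A y b) * 2 ^ (m + 1)}"
  have "2 * (card A * card B) = 2 * (\<Sum>a\<in>A. card B)" by simp
  also have "\<dots> \<le> 2 * (\<Sum>a\<in>A. card (nbrs B a b) * 2 ^ m)"
    by (intro mult_left_mono sum_mono assms) auto
  also have "\<dots> = (\<Sum>a\<in>A. card (nbrs B a b)) * 2 ^ (m + 1)"
    unfolding sum_distrib_right[symmetric] by simp
  also have "\<dots> = (\<Sum>y\<in>B. card (nbrs A y b) * 2 ^ (m + 1))"
    unfolding sum_card_nbrs_swap[OF assms(1,2)] by (simp add: sum_distrib_right)
  also have "\<dots> \<le> (\<Sum>y\<in>B. of_bool (y \<in> ?P) * (card A * 2 ^ (m + 1)) + card A)"
  proof (rule sum_mono)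
    fix y assume "y \<in> B"
    have "card (nbrs A y b) \<le> card A" using assms(1) by (intro card_mono) (auto simp: nbrs_def)
    then show "card (nbrs A y b) * 2 ^ (m + 1) \<le> of_bool (y \<in> ?P) * (card A * 2 ^ (m + 1)) + card A"
      using \<open>y \<in> B\<close> by (auto simp: trans_le_add1)
  qed
  also have "\<dots> = card ?P * (card A * 2 ^ (m + 1)) + card B * card A"
  proof -
    have "(\<Sum>y\<in>B. of_bool (y \<in> ?P)) = card ?P"
      using assms(2) by (simp add: of_bool_def sum.If_cases Int_def)
    then show ?thesis by (simp only: sum.distrib sum_distrib_right[symmetric]) simp
  qed
  finally have "card A * card B \<le> card A * (card ?P * 2 ^ (m + 1))" by (simp add: algebra_simps)
  moreover have "0 < card A" using assms(1,3) by (simp add: card_gt_0_iff)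
  ultimately show ?thesis by simp
qed

section \<open>Pairs between two consecutive scales\<close>

definition mid :: "nat \<Rightarrow> 'v set \<Rightarrow> ('v \<times> 'v) set" where
  "mid j Z = thin Z (2 ^ (5 + j)) - thin Z (2 ^ (6 + j))"

definition pop :: "nat \<Rightarrow> 'v set \<Rightarrow> 'c \<Rightarrow> nat" where
  "pop j Z b = card {p \<in> mid j Z. col (fst p) (snd p) = b}"

text \<open>
  The set \<open>W\<close> is the part of an earlier set \<open>Z\<close> to which every vertex of \<open>Y\<close> sends many edges of colour \<open>b\<close>.
  As the in-degree condition is pointwise, it survives in all subsets of \<open>Y\<close>, however sparse.
\<close>

definition trap :: "nat \<Rightarrow> nat \<Rightarrow> 'v set \<Rightarrow> bool" where
  "trap j l Y \<longleftrightarrow> (\<exists>Z W b. Z \<subseteq> V \<and> inefficient Z \<and> Y \<subseteq> Z \<and> W \<subseteq> Z \<and> W \<noteq> {} \<and>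
     lg Z - lg W \<le> 2 ^ (11 + 2 * j) + real l + 2 \<and>
     (\<forall>z\<in>Y. card W \<le> card (nbrs W z b) * 2 ^ (2 ^ (6 + j) + 1)))"

lemma trap_mono: "trap j l Y \<Longrightarrow> Y' \<subseteq> Y \<Longrightarrow> trap j l Y'"
  unfolding trap_def by blast

lemma finite_mid: "finite Z \<Longrightarrow> finite (mid j Z)"
  unfolding mid_def using finite_thin by blast

text \<open>The density of thin pairs is at least \<open>2 / 2 ^ (j + 2)\<close> at scale
  \<open>j\<close> and less than \<open>1 / 2 ^ (j + 2)\<close> at the next.\<close>

lemma card_mid:
  assumes "finite Z" "rich j Z" "\<not> rich (Suc j) Z"
  shows "(card Z)\<^sup>2 \<le> 2 ^ (j + 2) * card (mid j Z)"
proof -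
  have "card (thin Z (2 ^ (5 + j))) - card (thin Z (2 ^ (6 + j))) \<le> card (mid j Z)"
    unfolding mid_def by (rule diff_card_le_card_Diff[OF finite_thin[OF assms(1)]])
  then have "card (thin Z (2 ^ (5 + j))) \<le> card (mid j Z) + card (thin Z (2 ^ (6 + j)))" by linarith
  then have "2 ^ (j + 2) * card (thin Z (2 ^ (5 + j))) \<le> 2 ^ (j + 2) * (card (mid j Z) + card (thin Z (2 ^ (6 + j))))"
    by (rule mult_le_mono2)
  moreover have "2 * (card Z)\<^sup>2 \<le> 2 ^ (j + 2) * card (thin Z (2 ^ (5 + j)))"
    using assms(2) unfolding rich_def by simp
  moreover have "2 ^ (j + 2) * card (thin Z (2 ^ (6 + j))) < (card Z)\<^sup>2"
    using assms(3) unfolding rich_def by (simp add: not_le add.commute)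
  ultimately show ?thesis by (simp add: distrib_left)
qed

lemma pop_le:
  assumes "finite Z" shows "pop j Z b * 2 ^ 2 ^ (5 + j) \<le> (card Z)\<^sup>2"
proof -
  have "pop j Z b \<le> card {p \<in> thin Z (2 ^ (5 + j)). col (fst p) (snd p) = b}"
    unfolding pop_def mid_def using finite_thin[OF assms] by (intro card_mono) auto
  then show ?thesis using thin_colour_class[OF assms, of "2 ^ (5 + j)" b] by (meson le_trans mult_le_mono1)
qed

text \<open>A pair in \<open>mid\<close> is not thin at the finer scale, so at one of its ends its
  colour has large degree.\<close>

lemma pop_pairs_meet:
  assumes "finite Z"
  shows "pop j Z b \<le> 2 * (card {w \<in> Z. card Z \<le> card (nbrs Z w b) * 2 ^ 2 ^ (6 + j)} * card Z)"
proof -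
  let ?W = "{w \<in> Z. card Z \<le> card (nbrs Z w b) * 2 ^ 2 ^ (6 + j)}"
  have "{p \<in> mid j Z. col (fst p) (snd p) = b} \<subseteq> ?W \<times> Z \<union> Z \<times> ?W"
    unfolding mid_def thin_def by auto
  then have "pop j Z b \<le> card (?W \<times> Z \<union> Z \<times> ?W)"
    unfolding pop_def using assms by (intro card_mono) auto
  also have "\<dots> \<le> card (?W \<times> Z) + card (Z \<times> ?W)" by (rule card_Un_le)
  finally show ?thesis by (simp add: card_cartesian_product mult.commute)
qed

text \<open>The set \<open>mid j S\<close> has density at least \<open>4 / 2 ^ (j + 4)\<close>, and
  the colours in \<open>F\<close> cover at most \<open>1 / 2 ^ (j + 4)\<close>.\<close>

lemma mid_avoiding:
  assumes "finite S" "(card S)\<^sup>2 \<le> 2 ^ (j + 2) * card (mid j S)" "finite F"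
    and "\<And>b. pop j S b * 2 ^ l \<le> (card S)\<^sup>2" "real (card F) * 2 ^ (j + 4) \<le> 2 ^ l"
  shows "3 / 2 ^ (j + 4) * (real (card S))\<^sup>2 \<le> real (card {p \<in> mid j S. col (fst p) (snd p) \<notin> F})"
proof -
  let ?N = "(real (card S))\<^sup>2"
  let ?E = "{p \<in> mid j S. col (fst p) (snd p) \<notin> F}"
  have fin: "finite (mid j S)" using assms(1) by (rule finite_mid)
  have "mid j S \<subseteq> ?E \<union> (\<Union>b\<in>F. {p \<in> mid j S. col (fst p) (snd p) = b})" by auto
  then have "card (mid j S) \<le> card (?E \<union> (\<Union>b\<in>F. {p \<in> mid j S. col (fst p) (snd p) = b}))"
    using fin assms(3) by (intro card_mono) auto
  also have "\<dots> \<le> card ?E + card (\<Union>b\<in>F. {p \<in> mid j S. col (fst p) (snd p) = b})" by (rule card_Un_le)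
  also have "card (\<Union>b\<in>F. {p \<in> mid j S. col (fst p) (snd p) = b}) \<le> (\<Sum>b\<in>F. pop j S b)"
    unfolding pop_def by (rule card_UN_le[OF assms(3)])
  finally have "real (card (mid j S)) \<le> real (card ?E) + (\<Sum>b\<in>F. real (pop j S b))"
    by (simp add: of_nat_sum[symmetric] del: of_nat_sum)
  moreover have "(\<Sum>b\<in>F. real (pop j S b)) \<le> ?N / 2 ^ (j + 4)"
  proof -
    have "real (pop j S b) \<le> ?N / 2 ^ l" for b
    proof -
      have "real (pop j S b * 2 ^ l) \<le> real ((card S)\<^sup>2)" using assms(4) by (rule of_nat_mono)
      then show ?thesis by (simp add: field_simps)
    qed
    then have "(\<Sum>b\<in>F. real (pop j S b)) \<le> real (card F) * (?N / 2 ^ l)"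
      using sum_bounded_above[of F "\<lambda>b. real (pop j S b)" "?N / 2 ^ l"] by simp
    also have "\<dots> = (real (card F) * 2 ^ (j + 4)) * (?N / 2 ^ l / 2 ^ (j + 4))" by simp
    also have "\<dots> \<le> 2 ^ l * (?N / 2 ^ l / 2 ^ (j + 4))" by (intro mult_right_mono assms(5)) simp
    finally show ?thesis by simp
  qed
  moreover have "?N \<le> 2 ^ (j + 2) * real (card (mid j S))"
    using of_nat_mono[OF assms(2), where 'a = real] by simp
  then have "?N / 2 ^ (j + 2) \<le> real (card (mid j S))" by (simp add: field_simps)
  moreover have "?N / 2 ^ (j + 2) = 4 * (?N / 2 ^ (j + 4))" by (simp add: power_add)
  ultimately show ?thesis by simp
qed

lemma no_bip_cols_disjoint:
  assumes "W \<subseteq> V" "X \<subseteq> V" "\<And>w. w \<in> W \<Longrightarrow> X \<subseteq> nbrs V w b"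
  shows "cols W \<inter> cols X = {}"
proof (rule ccontr)
  assume "cols W \<inter> cols X \<noteq> {}"
  then obtain w w' x x' where h: "w \<in> W" "w' \<in> W" "w \<noteq> w'" "x \<in> X" "x' \<in> X" "x \<noteq> x'" "col w w' = col x x'"
    unfolding cols_def by auto
  have "x \<in> nbrs V w b" "x' \<in> nbrs V w b" "x \<in> nbrs V w' b" "x' \<in> nbrs V w' b"
    using assms(3) h by blast+
  then show False
    using no_bip[of w w' x x' b] h assms(1,2) unfolding nbrs_def by auto
qed

section \<open>A pair of parameters cannot occur twice\<close>

text \<open>Here \<open>W0\<close> comes from the earlier occurrence of \<open>(j, l)\<close>, and
  \<open>dense\<close> expresses the later one. A part \<open>W1\<close> of \<open>W0\<close> of
  controlled size is joined in colour \<open>b0\<close> to all vertices of one colourful tuple, and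
  loses more colours than an optimal choice of \<open>W\<close> inside \<open>W0\<close>
  permits.\<close>

lemma trap_contradiction:
  assumes Z: "Z \<subseteq> Z0" "Z \<noteq> {}"
    and Z0: "Z0 \<subseteq> V" "inefficient Z0" and W0: "W0 \<subseteq> Z0" "W0 \<noteq> {}"
    and cost: "lg Z0 - lg W0 \<le> 2 ^ (11 + 2 * j) + real l + 2"
    and in_deg: "\<And>z. z \<in> Z \<Longrightarrow> card W0 \<le> card (nbrs W0 z b0) * 2 ^ (2 ^ (6 + j) + 1)"
    and dense: "\<And>Y. Y \<subseteq> Z \<Longrightarrow> Y \<noteq> {} \<Longrightarrow> lg Z - lg Y \<le> 2 ^ (6 + j) + 2 \<Longrightarrow>
      \<exists>S. S \<subseteq> Y \<and> S \<noteq> {} \<and> lg Z - lg S \<le> 2 ^ (11 + 2 * j) \<and>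
        (card S)\<^sup>2 \<le> 2 ^ (j + 2) * card (mid j S) \<and> (\<forall>b. pop j S b * 2 ^ l \<le> (card S)\<^sup>2)"
    and l: "2 ^ (5 + j) \<le> l"
  shows False
proof -
  have finZ0: "finite Z0" and finZ: "finite Z" and finW0: "finite W0"
    using Z Z0 W0 finV finite_subset by metis+
  \<comment> \<open>Every vertex of \<open>Z\<close> has many neighbours in \<open>W0\<close>; hence
    many vertices of \<open>W0\<close> have many neighbours in \<open>Z\<close>.\<close>
  define W0' where "W0' = {w \<in> W0. card Z \<le> card (nbrs Z w b0) * 2 ^ (2 ^ (6 + j) + 1 + 1)}"
  have cW0': "card W0 \<le> card W0' * 2 ^ (2 ^ (6 + j) + 1 + 1)"
    unfolding W0'_def by (rule many_popular_vertices[OF finZ finW0 Z(2) in_deg])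
  have W0'sub: "W0' \<subseteq> W0" unfolding W0'_def by auto
  then have finW0': "finite W0'" using finW0 finite_subset by blast
  have W0'ne: "W0' \<noteq> {}"
    using cW0' W0(2) finW0 by (metis card.empty card_gt_0_iff mult_is_0 not_le)
  have lgW0': "lg W0 - lg W0' \<le> 2 ^ (6 + j) + 2"
    using lg_le_add[OF finW0 W0(2) finW0' cW0'] by simp
  have "\<forall>w\<in>W0'. \<exists>S. S \<subseteq> nbrs Z w b0 \<and> S \<noteq> {} \<and> lg Z - lg S \<le> 2 ^ (11 + 2 * j) \<and>
        (card S)\<^sup>2 \<le> 2 ^ (j + 2) * card (mid j S) \<and> (\<forall>b. pop j S b * 2 ^ l \<le> (card S)\<^sup>2)"
  proof
    fix w assume w: "w \<in> W0'"
    have c: "card Z \<le> card (nbrs Z w b0) * 2 ^ (2 ^ (6 + j) + 1 + 1)" using w unfolding W0'_def by simp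
    have n: "nbrs Z w b0 \<subseteq> Z" "finite (nbrs Z w b0)" using finZ unfolding nbrs_def by auto
    have "nbrs Z w b0 \<noteq> {}"
      using c Z(2) finZ by (metis card.empty card_gt_0_iff mult_is_0 not_le)
    moreover have "lg Z - lg (nbrs Z w b0) \<le> 2 ^ (6 + j) + 2"
      using lg_le_add[OF finZ Z(2) n(2) c] by simp
    ultimately show "\<exists>S. S \<subseteq> nbrs Z w b0 \<and> S \<noteq> {} \<and> lg Z - lg S \<le> 2 ^ (11 + 2 * j) \<and>
        (card S)\<^sup>2 \<le> 2 ^ (j + 2) * card (mid j S) \<and> (\<forall>b. pop j S b * 2 ^ l \<le> (card S)\<^sup>2)"
      using n(1) by (intro dense)
  qed
  from bchoice[OF this] obtain S where S: "\<And>w. w \<in> W0' \<Longrightarrow> S w \<subseteq> nbrs Z w b0 \<and> S w \<noteq> {} \<and>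
      lg Z - lg (S w) \<le> 2 ^ (11 + 2 * j) \<and> (card (S w))\<^sup>2 \<le> 2 ^ (j + 2) * card (mid j (S w)) \<and>
      (\<forall>b. pop j (S w) b * 2 ^ l \<le> (card (S w))\<^sup>2)" by blast
  have SZ: "S w \<subseteq> Z" "finite (S w)" if "w \<in> W0'" for w
  proof -
    show "S w \<subseteq> Z" using S[OF that] unfolding nbrs_def by blast
    then show "finite (S w)" using finZ finite_subset by blast
  qed
  have "finite {W. W \<subseteq> W0' \<and> W \<noteq> {}}" "{W. W \<subseteq> W0' \<and> W \<noteq> {}} \<noteq> {}"
    using finW0' W0'ne by auto
  \<comment> \<open>With the weight \<open>1024 / 3\<close>, the passage from \<open>W0'\<close> to
    \<open>W\<close> costs at most \<open>1024 / 3\<close> per colour of \<open>F\<close> below.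
    Multiplied by the \<open>3 / 2\<close> of \<open>inefficient\<close>, this is 512, which absorbs
    only half of the coefficient 1024.\<close>
  from finite_obtain_max[OF this, of "\<lambda>W. lg W - 1024 / 3 * real (card (cols W))"]
  obtain W where W: "W \<subseteq> W0'" "W \<noteq> {}" and
    Wmax: "\<And>W'. W' \<subseteq> W0' \<Longrightarrow> W' \<noteq> {} \<Longrightarrow>
      lg W' - 1024 / 3 * real (card (cols W')) \<le> lg W - 1024 / 3 * real (card (cols W))"
    by (metis (mono_tags, lifting) mem_Collect_eq)
  have WZ0: "W \<subseteq> Z0" using W W0'sub W0 by blast
  have finW: "finite W" using W finW0' finite_subset by blast
  \<comment> \<open>Colours outside \<open>W\<close> cannot be lost by a subset of \<open>W\<close>;
    tuples are therefore valued only by their colours outside \<open>F\<close>.\<close>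
  define F where "F = cols Z0 - cols W"
  have finF: "finite F" unfolding F_def using finite_cols[OF finZ0] by blast
  have cF: "real (card F) = real (card (cols Z0)) - real (card (cols W))"
    unfolding F_def using cols_mono[OF WZ0] finite_cols[OF finZ0] finite_cols[OF finW]
    by (simp add: card_Diff_subset card_mono)
  have F_small: "real (card F) * 2 ^ (j + 4) \<le> 2 ^ l"
  proof (rule excluded_colours_bound[OF l])
    have "1024 * real (card F) \<le> 3 / 2 * (lg Z0 - lg W)"
      using Z0(2) WZ0 W(2) unfolding cF inefficient_def by blast
    moreover have "lg W0' - 1024 / 3 * real (card (cols W0')) \<le> lg W - 1024 / 3 * real (card (cols W))"
      using Wmax W0'ne by blast
    moreover have "real (card (cols W0')) \<le> real (card (cols Z0))"
      using card_cols_mono[OF _ finZ0, of W0'] W0'sub W0(1) by auto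
    ultimately show "512 * real (card F) \<le> 3 / 2 * (2 ^ (11 + 2 * j) + real l + 2 + 2 ^ (6 + j) + 2)"
      using cost lgW0' cF by argo
  qed
  \<comment> \<open>The gain from a tuple is quadratic in \<open>q\<close> and the cost of fixing it
    is linear. This value makes the lower bound for the gain exactly twice the main cost
    \<open>\<theta>\<close>.\<close>
  define q where "q = (2::nat) ^ (10 + 3 * j)"
  define \<mu> where "\<mu> = (3::real) / 2 ^ (j + 4)"
  define good where "good x \<longleftrightarrow> \<mu> * real (q * (q - 1)) / 8 \<le> real (card (cols (x ` {..<q}) - F))" for x :: "nat \<Rightarrow> 'v"
  define T where "T w = {x \<in> PiE {..<q} (\<lambda>_. S w). good x}" for w
  have q2: "2 \<le> q"
    using power_increasing[of 1 "10 + 3 * j" "2::nat"] unfolding q_def by simp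
  have qc: "q * (q - 1) \<le> 2 ^ 2 ^ (5 + j)"
  proof -
    have "q * (q - 1) \<le> q * q" by simp
    also have "\<dots> = 2 ^ (20 + 6 * j)" unfolding q_def by (simp flip: power_add)
    also have "\<dots> \<le> 2 ^ 2 ^ (5 + j)"
    proof (rule power_increasing)
      have "20 + 6 * j \<le> 32 * (2::nat) ^ j" by (induction j) auto
      then show "20 + 6 * j \<le> 2 ^ (5 + j)" by (simp add: power_add)
    qed simp
    finally show ?thesis .
  qed
  have \<mu>pos: "0 < \<mu>" unfolding \<mu>_def by simp
  have T_card: "\<mu> / 4 * real (card (S w)) ^ q \<le> real (card (T w))" if w: "w \<in> W" for w
  proof -
    have w': "w \<in> W0'" using w W by blast
    let ?E = "{p \<in> mid j (S w). col (fst p) (snd p) \<notin> F}"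
    have sub: "?E \<subseteq> S w \<times> S w" unfolding mid_def thin_def by auto
    have "sym ?E"
      using sym_thin[of "S w"] unfolding mid_def sym_def by (auto simp: col_sym)
    have row: "real (card {y \<in> S w. (x, y) \<in> ?E \<and> col x y = b}) * 2 ^ 2 ^ (5 + j) \<le> real (card (S w))"
      if "x \<in> S w" for x b
    proof -
      have "card {y \<in> S w. (x, y) \<in> ?E \<and> col x y = b} * 2 ^ 2 ^ (5 + j)
        \<le> card {y \<in> S w. (x, y) \<in> thin (S w) (2 ^ (5 + j)) \<and> col x y = b} * 2 ^ 2 ^ (5 + j)"
        using SZ[OF w'] by (intro mult_right_mono card_mono) (auto simp: mid_def)
      also have "\<dots> \<le> card (S w)" using SZ[OF w'] that by (intro thin_row) auto
      finally show ?thesis using of_nat_mono[where 'a = real] by fastforce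
    qed
    have "3 / 2 ^ (j + 4) * (real (card (S w)))\<^sup>2 \<le> real (card ?E)"
      using S[OF w'] SZ[OF w'] finF F_small by (intro mid_avoiding[where l = l]) auto
    from many_colourful_tuples[OF SZ(2)[OF w'] sub \<open>sym ?E\<close> col_sym row this q2 qc]
    have "\<mu> / 4 * real (card (S w)) ^ q \<le> real (card {x \<in> PiE {..<q} (\<lambda>_. S w).
        \<mu> * real (q * (q - 1)) / 8 \<le> real (card {col (x i) (x j) | i j. i < j \<and> j < q \<and> (x i, x j) \<in> ?E})})"
      unfolding \<mu>_def by simp
    also have "\<dots> \<le> real (card (T w))"
    proof (intro of_nat_mono card_mono)
      show "finite (T w)" unfolding T_def using SZ[OF w'] by (auto intro!: finite_PiE)
      show "{x \<in> PiE {..<q} (\<lambda>_. S w). \<mu> * real (q * (q - 1)) / 8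
          \<le> real (card {col (x i) (x j) | i j. i < j \<and> j < q \<and> (x i, x j) \<in> ?E})} \<subseteq> T w"
      proof
        fix x assume x: "x \<in> {x \<in> PiE {..<q} (\<lambda>_. S w). \<mu> * real (q * (q - 1)) / 8
          \<le> real (card {col (x i) (x j) | i j. i < j \<and> j < q \<and> (x i, x j) \<in> ?E})}"
        have "{col (x i) (x j) | i j. i < j \<and> j < q \<and> (x i, x j) \<in> ?E} \<subseteq> cols (x ` {..<q}) - F"
        proof
          fix b assume "b \<in> {col (x i) (x j) | i j. i < j \<and> j < q \<and> (x i, x j) \<in> ?E}"
          then obtain i j' where ij: "b = col (x i) (x j')" "i < j'" "j' < q" "(x i, x j') \<in> ?E" by blast
          then have "x i \<noteq> x j'" unfolding mid_def thin_def by auto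
          moreover have "x i \<in> x ` {..<q}" "x j' \<in> x ` {..<q}" using ij by auto
          ultimately have "b \<in> cols (x ` {..<q})" unfolding cols_def ij(1) by blast
          then show "b \<in> cols (x ` {..<q}) - F" using ij by auto
        qed
        then have "card {col (x i) (x j) | i j. i < j \<and> j < q \<and> (x i, x j) \<in> ?E} \<le> card (cols (x ` {..<q}) - F)"
          by (intro card_mono) (auto intro: finite_cols)
        then have "good x" unfolding good_def using x by auto
        then show "x \<in> T w" unfolding T_def using x by auto
      qed
    qed
    finally show ?thesis .
  qed
  define \<Omega> where "\<Omega> = PiE {..<q} (\<lambda>_. Z)"
  \<comment> \<open>Each \<open>S w\<close> has density at least
    \<open>2 powr (- (2 ^ (11 + 2 * j)))\<close> in \<open>Z\<close>, so its \<open>q\<close>-tuples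
    have density at least \<open>2 powr (- \<theta>)\<close> in \<open>\<Omega>\<close>; a fraction
    of at least \<open>\<mu> / 4\<close> of them is good.\<close>
  define \<theta> where "\<theta> = real (q * 2 ^ (11 + 2 * j))"
  define \<kappa> where "\<kappa> = \<mu> / 4 * 2 powr (- \<theta>)"
  have fin\<Omega>: "finite \<Omega>" and card\<Omega>: "real (card \<Omega>) = real (card Z) ^ q"
    unfolding \<Omega>_def using finZ by (auto intro!: finite_PiE simp: card_PiE)
  have cZ: "0 < card Z" using finZ Z(2) by (simp add: card_gt_0_iff)
  have T_card': "\<kappa> * real (card \<Omega>) \<le> real (card (T w))" if w: "w \<in> W" for w
  proof -
    have w': "w \<in> W0'" using w W by blast
    have "real (card Z) * 2 powr (- (2 ^ (11 + 2 * j))) \<le> real (card (S w))"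
      using S[OF w'] SZ[OF w'] finZ Z(2) by (intro card_ge_of_lg) auto
    then have "(real (card Z) * 2 powr (- (2 ^ (11 + 2 * j)))) ^ q \<le> real (card (S w)) ^ q"
      by (intro power_mono) auto
    moreover have "(2 powr (- (2 ^ (11 + 2 * j))) :: real) ^ q = 2 powr (- \<theta>)"
      unfolding \<theta>_def by (simp add: powr_powr mult.commute flip: powr_realpow)
    ultimately have "real (card \<Omega>) * 2 powr (- \<theta>) \<le> real (card (S w)) ^ q"
      unfolding card\<Omega> by (simp add: power_mult_distrib)
    then have "\<mu> / 4 * (real (card \<Omega>) * 2 powr (- \<theta>)) \<le> \<mu> / 4 * real (card (S w)) ^ q"
      using \<mu>pos by (intro mult_left_mono) auto
    then show ?thesis using T_card[OF w] unfolding \<kappa>_def by (simp add: mult_ac)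
  qed
  \<comment> \<open>Averaging over the tuples: every \<open>T w\<close> has density at least
    \<open>\<kappa>\<close> in \<open>\<Omega>\<close>, so some tuple lies in \<open>T w\<close> for
    a fraction \<open>\<kappa>\<close> of all \<open>w\<close>.\<close>
  have "\<exists>x\<in>\<Omega>. \<kappa> * real (card W) \<le> real (card {w \<in> W. x \<in> T w})"
  proof (rule ccontr)
    assume "\<not> ?thesis"
    then have *: "\<And>x. x \<in> \<Omega> \<Longrightarrow> real (card {w \<in> W. x \<in> T w}) < \<kappa> * real (card W)" by (simp add: not_le)
    have "(\<Sum>w\<in>W. real (card (T w))) = (\<Sum>w\<in>W. \<Sum>x\<in>\<Omega>. of_bool (x \<in> T w))"
    proof (rule sum.cong)
      fix w assume "w \<in> W"
      then have "w \<in> W0'" using W by blast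
      then have "T w \<subseteq> \<Omega>" using PiE_mono[of "{..<q}" "\<lambda>_. S w" "\<lambda>_. Z"] SZ(1) unfolding T_def \<Omega>_def by auto
      then show "real (card (T w)) = (\<Sum>x\<in>\<Omega>. of_bool (x \<in> T w))"
        using fin\<Omega> by (simp add: of_bool_def sum.If_cases Int_absorb1)
    qed simp
    also have "\<dots> = (\<Sum>x\<in>\<Omega>. \<Sum>w\<in>W. of_bool (x \<in> T w))" by (rule sum.swap)
    also have "\<dots> = (\<Sum>x\<in>\<Omega>. real (card {w \<in> W. x \<in> T w}))"
      using finW by (simp add: of_bool_def sum.If_cases Int_def)
    also have "\<dots> < (\<Sum>x\<in>\<Omega>. \<kappa> * real (card W))"
    proof (rule sum_strict_mono)
      have "0 < real (card \<Omega>)" unfolding card\<Omega> using cZ by simp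
      then show "\<Omega> \<noteq> {}" by auto
    qed (use fin\<Omega> * in auto)
    also have "\<dots> = (\<Sum>w\<in>W. \<kappa> * real (card \<Omega>))" by (simp add: mult_ac)
    also have "\<dots> \<le> (\<Sum>w\<in>W. real (card (T w)))" by (intro sum_mono T_card')
    finally show False by simp
  qed
  then obtain x where x: "x \<in> \<Omega>" "\<kappa> * real (card W) \<le> real (card {w \<in> W. x \<in> T w})" by blast
  define W1 where "W1 = {w \<in> W. x \<in> T w}"
  define X where "X = x ` {..<q}"
  have cW: "0 < card W" using finW W(2) by (simp add: card_gt_0_iff)
  have \<kappa>pos: "0 < \<kappa>" unfolding \<kappa>_def using \<mu>pos by simp
  have finW1: "finite W1" unfolding W1_def using finW by simp
  have cW1: "0 < real (card W1)"
    using x(2) cW \<kappa>pos unfolding W1_def by (meson less_le_trans mult_pos_pos of_nat_0_less_iff)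
  then have W1ne: "W1 \<noteq> {}" by auto
  then have gx: "good x" unfolding W1_def T_def by auto
  have XZ: "X \<subseteq> Z" using x(1) unfolding X_def \<Omega>_def by (auto simp: PiE_iff)
  have "cols W1 \<inter> cols X = {}"
  proof (rule no_bip_cols_disjoint[where b = b0])
    show "W1 \<subseteq> V" "X \<subseteq> V" using WZ0 XZ Z Z0 unfolding W1_def by blast+
    fix w assume w: "w \<in> W1"
    then have "w \<in> W0'" "X \<subseteq> S w" using W unfolding W1_def T_def X_def by (auto simp: PiE_iff)
    then show "X \<subseteq> nbrs V w b0" using S[of w] Z Z0 unfolding nbrs_def by blast
  qed
  moreover have "cols X - F \<subseteq> cols W"
    using cols_mono[of X Z0] XZ Z unfolding F_def by blast
  moreover have "cols W1 \<subseteq> cols W" by (rule cols_mono) (auto simp: W1_def)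
  ultimately have "cols W1 \<subseteq> cols W - (cols X - F)" by blast
  then have "card (cols W1) \<le> card (cols W - (cols X - F))"
    by (intro card_mono) (auto simp: finite_cols finW)
  also have "\<dots> = card (cols W) - card (cols X - F)"
    using \<open>cols X - F \<subseteq> cols W\<close> finite_cols[OF finW] by (intro card_Diff_subset) (auto intro: finite_subset)
  finally have "real (card (cols W1)) + real (card (cols X - F)) \<le> real (card (cols W))"
    using card_mono[OF finite_cols[OF finW] \<open>cols X - F \<subseteq> cols W\<close>] by linarith
  moreover have "lg W1 - 1024 / 3 * real (card (cols W1)) \<le> lg W - 1024 / 3 * real (card (cols W))"
    using W1ne W by (intro Wmax) (auto simp: W1_def)
  ultimately have gain: "1024 / 3 * real (card (cols X - F)) \<le> lg W - lg W1" by argo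
  have "lg W - lg W1 \<le> \<theta> + real j + 5"
  proof -
    have "lg W + log 2 \<kappa> = log 2 (\<kappa> * real (card W))"
      unfolding lg_def using cW \<kappa>pos by (simp add: log_mult)
    also have "\<dots> \<le> lg W1" unfolding lg_def using x(2) cW \<kappa>pos cW1 unfolding W1_def by (subst log_le_cancel_iff) auto
    finally have "lg W - lg W1 \<le> - log 2 \<kappa>" by simp
    moreover have "log 2 \<kappa> = log 2 (\<mu> / 4) - \<theta>" unfolding \<kappa>_def using \<mu>pos by (subst log_mult) auto
    moreover have "- real (j + 5) \<le> log 2 (\<mu> / 4)"
    proof -
      have "(1::real) / 2 ^ (j + 5) \<le> \<mu> / 4" unfolding \<mu>_def by (simp add: power_add field_simps)
      then have "log 2 (1 / 2 ^ (j + 5)) \<le> log 2 (\<mu> / 4)" by (subst log_le_cancel_iff) (use \<mu>pos in auto)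
      moreover have "log 2 ((1::real) / 2 ^ (j + 5)) = - real (j + 5)"
        by (subst log_divide) (auto simp: log_nat_power)
      ultimately show ?thesis by simp
    qed
    ultimately show ?thesis by simp
  qed
  moreover have "1024 / 3 * (\<mu> * real (q * (q - 1)) / 8) \<le> 1024 / 3 * real (card (cols X - F))"
    using gx unfolding good_def X_def by (intro mult_left_mono) auto
  moreover have "1024 / 3 * (\<mu> * real (q * (q - 1)) / 8) \<ge> 2 * \<theta>"
  proof -
    have "real q / 2 \<le> real (q - 1)" using q2 by (simp add: of_nat_diff)
    then have "real q * (real q / 2) \<le> real q * real (q - 1)" by (intro mult_left_mono) auto
    then have "real q * real q / 2 \<le> real (q * (q - 1))" by simp
    moreover have "1024 / 3 * (\<mu> * real (q * (q - 1)) / 8) = 8 / 2 ^ j * real (q * (q - 1))"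
      unfolding \<mu>_def by (simp add: power_add)
    moreover have "8 / 2 ^ j * (real q * real q / 2) = 2 * \<theta>"
    proof -
      have "10 + 3 * j = 10 + 2 * j + j" by simp
      then have "real q = 1024 * 2 ^ (2 * j) * 2 ^ j" unfolding q_def by (simp only: power_add) simp
      then have "8 / 2 ^ j * (real q * real q / 2) = real q * (4096 * 2 ^ (2 * j))" by (simp add: field_simps)
      then show ?thesis unfolding \<theta>_def by (simp add: power_add)
    qed
    ultimately show ?thesis
      using mult_left_mono[of "real q * real q / 2" "real (q * (q - 1))" "8 / 2 ^ j"] by simp
  qed
  moreover have "real j + 5 < \<theta>"
  proof -
    have "j < 2 ^ j" by (rule less_exp)
    also have "(2::nat) ^ j \<le> q" unfolding q_def by (intro power_increasing) auto
    finally have "j < q" .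
    then have "j + 5 < q * 2048" by simp
    also have "\<dots> \<le> q * 2 ^ (11 + 2 * j)" by (simp add: power_add)
    finally have "real (j + 5) < \<theta>" unfolding \<theta>_def by (rule less_imp_of_nat_less)
    then show ?thesis by simp
  qed
  ultimately show False using gain by argo
qed

section \<open>The iteration\<close>

text \<open>One step of the iteration. The scale \<open>j\<close> and the frequency \<open>l\<close>
  are read off a maximiser \<open>Z\<close> of the potential inside \<open>Y\<close>. If
  \<open>Y\<close> already had a trap for them, \<open>Z\<close> would lie in it as well and
  \<open>trap_contradiction\<close> would apply.\<close>

lemma exists_new_trap:
  assumes Y: "Y \<subseteq> V" "Y \<noteq> {}" "2 \<le> potential Y"
  obtains j l Y' where "j \<le> K" "l \<le> 2 * K + 2" "Y' \<subseteq> Y" "Y' \<noteq> {}"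
    "potential Y - 12 * (real K + 1)\<^sup>2 \<le> potential Y'" "trap j l Y'" "\<not> trap j l Y"
proof -
  have finY: "finite Y" using Y finV finite_subset by blast
  have "finite {Z. Z \<subseteq> Y \<and> Z \<noteq> {}}" "{Z. Z \<subseteq> Y \<and> Z \<noteq> {}} \<noteq> {}" using finY Y(2) by auto
  from finite_obtain_max[OF this, of potential] obtain Z where
    Z: "Z \<subseteq> Y" "Z \<noteq> {}" and Zm: "\<And>Z'. Z' \<subseteq> Y \<Longrightarrow> Z' \<noteq> {} \<Longrightarrow> potential Z' \<le> potential Z"
    by (metis (mono_tags, lifting) mem_Collect_eq)
  have ZV: "Z \<subseteq> V" and finZ: "finite Z" using Z(1) Y(1) finY finite_subset by blast+
  have max: "maximal Z" unfolding maximal_def using Zm Z(1) by blast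
  have "2 \<le> potential Z" using Zm[of Y] Y by force
  moreover have "0 \<le> (\<Sum>j\<le>K. richness j Z)" by (intro sum_nonneg richness_nonneg finZ)
  \<comment> \<open>The bound 2 on the potential ensures at least four vertices, more than the three
    that \<open>maximal_rich_0\<close> requires.\<close>
  ultimately have "2 \<le> lg Z" unfolding potential_def by simp
  then have "2 powr 2 \<le> 2 powr (lg Z)" by (intro powr_mono) auto
  moreover have "2 powr (lg Z) = real (card Z)"
    using finZ Z(2) unfolding lg_def by (subst powr_log_cancel) (auto simp: card_gt_0_iff)
  ultimately have "4 \<le> real (card Z)" by simp
  then have "rich 0 Z" using max ZV by (intro maximal_rich_0) auto
  then have r0: "2 ^ 4 \<le> richness 0 Z" using richness_ge[of Z Z 0] finZ Z(2) by simp
  \<comment> \<open>The last scale at which the richness reaches half of its upper bound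
    \<open>2 ^ (5 + j)\<close>: rich subsets are available there, and rarer at the next
    scale.\<close>
  define J where "J = {j. j \<le> K \<and> 2 ^ (4 + j) \<le> richness j Z}"
  define j where "j = Max J"
  have finJ: "finite J" and "0 \<in> J" using r0 unfolding J_def by auto
  then have jJ: "j \<in> J" unfolding j_def by (intro Max_in) auto
  then have jK: "j \<le> K" and rj: "2 ^ (4 + j) \<le> richness j Z" unfolding J_def by auto
  have richb: "2 ^ (5 + i) \<le> K + i + 1" if "0 < richness i Z" for i
    using richness_pos[OF finZ that] rich_bound ZV by (metis subset_trans)
  have rSj: "richness (Suc j) Z < 2 ^ (5 + j)"
  proof (cases "Suc j \<le> K")
    case True
    have "Suc j \<notin> J" using Max_ge[OF finJ, of "Suc j"] unfolding j_def by auto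
    then show ?thesis using True unfolding J_def by simp
  next
    \<comment> \<open>The range of scales ends at \<open>K\<close>, so the next scale has to be
      excluded by \<open>rich_bound\<close>.\<close>
    case False
    have "\<not> 0 < richness (Suc j) Z"
    proof
      assume "0 < richness (Suc j) Z"
      then have "2 ^ (5 + Suc j) \<le> K + Suc j + 1" by (rule richb)
      moreover have "j = K" using False jK by simp
      moreover have "K < 2 ^ K" by (rule less_exp)
      ultimately show False by (simp add: power_add)
    qed
    then show ?thesis by (smt (verit) zero_less_power)
  qed
  have rj0: "0 < richness j Z" using rj by (smt (verit) zero_less_power)
  have cK: "2 ^ (5 + j) \<le> K + j + 1" using richb[OF rj0] .
  define c where "c = (2::real) ^ (5 + j)"
  have cpos: "32 \<le> c" unfolding c_def by (simp add: power_add)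
  have c_eqs: "(2::real) ^ (4 + j) = c / 2" "(2::real) ^ (6 + j) = 2 * c" "(2::real) ^ (7 + j) = 4 * c"
    "(2::real) ^ (11 + 2 * j) = 2 * c\<^sup>2"
    unfolding c_def by (simp_all add: power_add power_mult power2_eq_square power_mult_distrib[symmetric])
  \<comment> \<open>The density bound is chosen so that no member of \<open>G\<close> is rich at
    scale \<open>Suc j\<close>: such a set would give richness at least \<open>3 / 2 * c\<close>
    there, but the value is below \<open>c\<close>.\<close>
  define G where "G = {S. S \<subseteq> Z \<and> S \<noteq> {} \<and> rich j S \<and> lg Z - lg S \<le> 2 ^ (11 + 2 * j)}"
  have finG: "finite G" unfolding G_def using finZ by auto
  have finS: "finite S" if "S \<in> G" for S using that finZ finite_subset unfolding G_def by blast
  have G_mid: "(card S)\<^sup>2 \<le> 2 ^ (j + 2) * card (mid j S)" if S: "S \<in> G" for S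
  proof (rule card_mid[OF finS[OF S]])
    show "rich j S" using S unfolding G_def by simp
    show "\<not> rich (Suc j) S"
    proof
      assume "rich (Suc j) S"
      then have "2 ^ (5 + Suc j) - (lg Z - lg S) / 2 ^ (6 + Suc j) \<le> richness (Suc j) Z"
        using S finZ unfolding G_def by (intro richness_ge) auto
      then have "2 * c - (lg Z - lg S) / (4 * c) < c"
        using rSj c_eqs(2,3) unfolding c_def[symmetric] by (simp add: add.commute)
      then have "4 * c\<^sup>2 < lg Z - lg S" using cpos by (simp add: field_simps power2_eq_square)
      moreover have "lg Z - lg S \<le> 2 * c\<^sup>2" using S unfolding G_def c_eqs by simp
      moreover have "0 \<le> c\<^sup>2" by simp
      ultimately show False by linarith
    qed
  qed
  obtain S0 where S0: "S0 \<in> G"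
  proof -
    obtain S where S: "S \<subseteq> Z" "S \<noteq> {}" "rich j S"
      "richness j Z = 2 ^ (5 + j) - (lg Z - lg S) / 2 ^ (6 + j)"
      using richness_pos[OF finZ rj0] by metis
    have "c / 2 \<le> c - (lg Z - lg S) / (2 * c)" using rj S(4) unfolding c_eqs c_def[symmetric] by simp
    then have "lg Z - lg S \<le> c\<^sup>2" using cpos by (simp add: field_simps power2_eq_square)
    moreover have "0 \<le> c\<^sup>2" by simp
    ultimately have "lg Z - lg S \<le> 2 ^ (11 + 2 * j)" unfolding c_eqs by linarith
    then show ?thesis using that S unfolding G_def by blast
  qed
  define dens where "dens p = real (pop j (fst p) (snd p)) / (real (card (fst p)))\<^sup>2" for p
  have Gcard: "0 < card S" if "S \<in> G" for S
    using finS[OF that] that unfolding G_def by (simp add: card_gt_0_iff)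
  have G_dens: "\<exists>b\<in>cols V. 1 \<le> 2 ^ (j + 2 + K) * dens (S, b)" if S: "S \<in> G" for S
  proof (rule ccontr)
    assume "\<not> ?thesis"
    then have *: "\<And>b. b \<in> cols V \<Longrightarrow> 2 ^ (j + 2 + K) * dens (S, b) < 1" by (simp add: not_le)
    have SV: "S \<subseteq> V" using S ZV unfolding G_def by blast
    have "real (card (mid j S)) \<le> real (\<Sum>b\<in>cols S. pop j S b)"
      unfolding pop_def
      by (intro of_nat_mono card_le_sum_colour_classes[OF finS[OF S]]) (auto simp: mid_def)
    then have m: "real (card (mid j S)) \<le> (\<Sum>b\<in>cols S. real (pop j S b))" by simp
    have N: "0 < (real (card S))\<^sup>2" using Gcard[OF S] by simp
    have pb: "real (pop j S b) < (real (card S))\<^sup>2 / 2 ^ (j + 2 + K)" if "b \<in> cols S" for b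
      using *[of b] cols_mono[OF SV] that N unfolding dens_def by (auto simp: field_simps)
    have "(real (card S))\<^sup>2 \<le> 2 ^ (j + 2) * real (card (mid j S))"
      using of_nat_mono[OF G_mid[OF S], where 'a = real] by simp
    moreover have "cols S \<noteq> {}"
    proof
      assume "cols S = {}"
      then have "real (card (mid j S)) \<le> 0" using m by simp
      then show False using calculation N by simp
    qed
    then have "(\<Sum>b\<in>cols S. real (pop j S b)) < (\<Sum>b\<in>cols S. (real (card S))\<^sup>2 / 2 ^ (j + 2 + K))"
      using pb by (intro sum_strict_mono finite_cols finS S) auto
    moreover have "\<dots> \<le> 2 ^ K * ((real (card S))\<^sup>2 / 2 ^ (j + 2 + K))"
      using of_nat_mono[OF card_cols_le[OF SV], where 'a = real] by (simp only: sum_constant) (intro mult_right_mono, auto)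
    ultimately have "(real (card S))\<^sup>2 < 2 ^ (j + 2) * (2 ^ K * ((real (card S))\<^sup>2 / 2 ^ (j + 2 + K)))"
      using m by (smt (verit) mult_strict_left_mono zero_less_power)
    then show False by (simp add: power_add)
  qed
  have "G \<times> cols V \<noteq> {}" "finite (G \<times> cols V)"
    using S0 G_dens[OF S0] finG finite_cols[OF finV] by auto
  \<comment> \<open>Maximising over the set and the colour jointly bounds the frequency of every
    colour in every member of \<open>G\<close>; this is what \<open>dense\<close> asks for at a
    later occurrence.\<close>
  from finite_obtain_max[OF this(2,1), of dens] obtain p where
    p: "p \<in> G \<times> cols V" and pmax: "\<And>p'. p' \<in> G \<times> cols V \<Longrightarrow> dens p' \<le> dens p" by blast
  define S where "S = fst p"
  define b where "b = snd p"
  define \<rho> where "\<rho> = dens (S, b)"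
  have SG: "S \<in> G" using p unfolding S_def by auto
  have SZ: "S \<subseteq> Z" "S \<noteq> {}" "lg Z - lg S \<le> 2 ^ (11 + 2 * j)" using SG unfolding G_def by auto
  have \<rho>max: "dens (S', b') \<le> \<rho>" if "S' \<in> G" "b' \<in> cols V" for S' b'
    using pmax[of "(S', b')"] that unfolding \<rho>_def S_def b_def by simp
  have \<rho>ge: "1 \<le> 2 ^ (j + 2 + K) * \<rho>"
  proof -
    obtain b' where "b' \<in> cols V" "1 \<le> 2 ^ (j + 2 + K) * dens (S, b')" using G_dens[OF SG] by blast
    moreover have "2 ^ (j + 2 + K) * dens (S, b') \<le> 2 ^ (j + 2 + K) * \<rho>"
      using \<rho>max[OF SG \<open>b' \<in> cols V\<close>] by (intro mult_left_mono) auto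
    ultimately show ?thesis by linarith
  qed
  then have \<rho>pos: "0 < \<rho>" by (smt (verit) mult_nonneg_nonpos zero_le_power)
  have N: "0 < real (card S)" using Gcard[OF SG] by simp
  have \<rho>le: "2 ^ 2 ^ (5 + j) \<le> 1 / \<rho>"
  proof -
    have "real (pop j S b * 2 ^ 2 ^ (5 + j)) \<le> real ((card S)\<^sup>2)"
      using pop_le[OF finS[OF SG]] by (rule of_nat_mono)
    then have "\<rho> * 2 ^ 2 ^ (5 + j) \<le> 1" unfolding \<rho>_def dens_def using N by (simp add: field_simps)
    then show ?thesis using \<rho>pos by (simp add: field_simps)
  qed
  have "1 \<le> 1 / \<rho>" using \<rho>le by (smt (verit) one_le_power)
  then obtain l :: nat where l: "2 ^ l \<le> 1 / \<rho>" "1 / \<rho> < 2 ^ (l + 1)" by (rule power2_floor_log)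
  have cl: "2 ^ (5 + j) \<le> l"
  proof -
    have "(2::real) ^ 2 ^ (5 + j) < 2 ^ (l + 1)" using \<rho>le l(2) by linarith
    then have "2 ^ (5 + j) < l + 1" by (rule power_less_imp_less_exp[rotated]) simp
    then show ?thesis by simp
  qed
  have lK: "l \<le> 2 * K + 2"
  proof -
    have "1 / \<rho> \<le> 2 ^ (j + 2 + K)" using \<rho>ge \<rho>pos by (simp add: field_simps)
    then have "(2::real) ^ l \<le> 2 ^ (j + 2 + K)" using l(1) by linarith
    then have "l \<le> j + 2 + K" by (rule power_le_imp_le_exp[rotated]) simp
    then show ?thesis using jK by simp
  qed
  have pop_bound: "pop j S' b' * 2 ^ l \<le> (card S')\<^sup>2" if S': "S' \<in> G" for S' b'
  proof (cases "b' \<in> cols V")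
    case True
    have "dens (S', b') * 2 ^ l \<le> \<rho> * (1 / \<rho>)"
      using \<rho>max[OF S' True] l(1) \<rho>pos by (intro mult_mono) auto
    then have "real (pop j S' b') * 2 ^ l \<le> (real (card S'))\<^sup>2"
      using Gcard[OF S'] \<rho>pos unfolding dens_def by (simp add: field_simps)
    then have "real (pop j S' b' * 2 ^ l) \<le> real ((card S')\<^sup>2)" by simp
    then show ?thesis by (simp only: of_nat_le_iff)
  next
    case False
    have "S' \<subseteq> V" using S' ZV unfolding G_def by blast
    then have "{p \<in> mid j S'. col (fst p) (snd p) = b'} = {}"
      using False unfolding mid_def thin_def cols_def by auto
    then show ?thesis unfolding pop_def by (metis card.empty mult_zero_left zero_le)
  qed
  define W where "W = {w \<in> S. card S \<le> card (nbrs S w b) * 2 ^ 2 ^ (6 + j)}"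
  have WS: "W \<subseteq> S" "finite W" unfolding W_def using finS[OF SG] by auto
  \<comment> \<open>Colour \<open>b\<close> has frequency above \<open>1 / 2 ^ (l + 1)\<close>, and
    each of its pairs in \<open>mid j S\<close> meets \<open>W\<close>; the two orders of a pair
    give one more factor 2.\<close>
  have cSW: "card S \<le> card W * 2 ^ (l + 2)"
  proof -
    have "real (pop j S b) \<le> real (2 * (card W * card S))"
      unfolding W_def by (intro of_nat_mono pop_pairs_meet finS SG)
    then have "\<rho> * real (card S) \<le> 2 * real (card W)"
      unfolding \<rho>_def dens_def using N by (simp add: field_simps power2_eq_square)
    moreover have "1 < 2 ^ (l + 1) * \<rho>" using l(2) \<rho>pos by (simp add: field_simps)
    then have "1 * real (card S) \<le> (2 ^ (l + 1) * \<rho>) * real (card S)" by (intro mult_right_mono) auto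
    ultimately have "real (card S) \<le> 2 ^ (l + 1) * (2 * real (card W))"
      by (smt (verit) mult.assoc mult_left_mono zero_le_power)
    then have "real (card S) \<le> real (card W * 2 ^ (l + 2))" by (simp add: mult_ac)
    then show ?thesis by (simp only: of_nat_le_iff)
  qed
  have Wne: "W \<noteq> {}" using cSW Gcard[OF SG] by auto
  have lgW: "lg S - lg W \<le> real l + 2" using lg_le_add[OF finS[OF SG] SZ(2) WS(2) cSW] by simp
  define Y' where "Y' = {z \<in> S. card W \<le> card (nbrs W z b) * 2 ^ (2 ^ (6 + j) + 1)}"
  have cSY': "card S \<le> card Y' * 2 ^ (2 ^ (6 + j) + 1)"
    unfolding Y'_def by (rule many_popular_vertices[OF WS(2) finS[OF SG] Wne]) (auto simp: W_def)
  have Y'S: "Y' \<subseteq> S" "finite Y'" unfolding Y'_def using finS[OF SG] by auto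
  have Y'ne: "Y' \<noteq> {}" using cSY' Gcard[OF SG] by auto
  have lgY': "lg S - lg Y' \<le> 2 ^ (6 + j) + 1"
    using lg_le_add[OF finS[OF SG] SZ(2) Y'S(2) cSY'] by simp
  have "trap j l Y'"
    unfolding trap_def
  proof (intro exI conjI ballI)
    show "lg Z - lg W \<le> 2 ^ (11 + 2 * j) + real l + 2" using SZ(3) lgW by linarith
    show "inefficient Z" using finZ max by (rule maximal_inefficient)
    show "card W \<le> card (nbrs W z b) * 2 ^ (2 ^ (6 + j) + 1)" if "z \<in> Y'" for z
      using that unfolding Y'_def by simp
  qed (use ZV Y'S WS SZ Wne in auto)
  moreover have "\<not> trap j l Y"
  proof
    assume "trap j l Y"
    then obtain Z0 W0 b0 where h: "Z0 \<subseteq> V" "inefficient Z0" "Y \<subseteq> Z0" "W0 \<subseteq> Z0" "W0 \<noteq> {}"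
      "lg Z0 - lg W0 \<le> 2 ^ (11 + 2 * j) + real l + 2"
      "\<forall>z\<in>Y. card W0 \<le> card (nbrs W0 z b0) * 2 ^ (2 ^ (6 + j) + 1)"
      unfolding trap_def by blast
    show False
    proof (rule trap_contradiction[of Z Z0 W0 j l b0])
      show "Z \<subseteq> Z0" using Z h by blast
      show "card W0 \<le> card (nbrs W0 z b0) * 2 ^ (2 ^ (6 + j) + 1)" if "z \<in> Z" for z
        using h(7) Z(1) that by blast
      show "\<exists>S. S \<subseteq> Y2 \<and> S \<noteq> {} \<and> lg Z - lg S \<le> 2 ^ (11 + 2 * j) \<and>
        (card S)\<^sup>2 \<le> 2 ^ (j + 2) * card (mid j S) \<and> (\<forall>b. pop j S b * 2 ^ l \<le> (card S)\<^sup>2)"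
        if Y2: "Y2 \<subseteq> Z" "Y2 \<noteq> {}" "lg Z - lg Y2 \<le> 2 ^ (6 + j) + 2" for Y2
      proof -
        have finY2: "finite Y2" using Y2 finZ finite_subset by blast
        \<comment> \<open>Of the initial \<open>c / 2\<close>, at least \<open>c / 4\<close>
          survives in \<open>Y2\<close>. A rich subset of \<open>Y2\<close> therefore costs at most
          \<open>3 / 2 * c ^ 2\<close> more, and \<open>32 \<le> c\<close> leaves room for the
          \<open>2 * c + 2\<close> already spent.\<close>
        have "richness j Z - 3 / 32 * (lg Z - lg Y2) \<le> richness j Y2"
          using maximal_richness[OF finZ max Y2(1,2) jK] .
        then have r: "c / 4 \<le> richness j Y2" using rj Y2(3) cpos unfolding c_eqs by argo
        then have "0 < richness j Y2" using cpos by linarith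
        from richness_pos[OF finY2 this] obtain S' where S': "S' \<subseteq> Y2" "S' \<noteq> {}" "rich j S'"
          "richness j Y2 = 2 ^ (5 + j) - (lg Y2 - lg S') / 2 ^ (6 + j)" by metis
        have "c / 4 \<le> c - (lg Y2 - lg S') / (2 * c)" using r S'(4) unfolding c_eqs c_def[symmetric] by simp
        then have "lg Y2 - lg S' \<le> 3 / 2 * c\<^sup>2" using cpos by (simp add: field_simps power2_eq_square)
        moreover have "32 * c \<le> c\<^sup>2" using mult_right_mono[OF cpos, of c] cpos by (simp add: power2_eq_square)
        ultimately have "lg Z - lg S' \<le> 2 * c\<^sup>2" using Y2(3) cpos unfolding c_eqs by argo
        then have "S' \<in> G" using S' Y2 unfolding G_def c_eqs by auto
        then show ?thesis using S' G_mid[of S'] pop_bound[of S'] unfolding G_def by blast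
      qed
    qed (use Z h cl in auto)
  qed
  moreover have "potential Y - 12 * (real K + 1)\<^sup>2 \<le> potential Y'"
  proof -
    \<comment> \<open>The total loss in \<open>lg\<close> is at most
      \<open>2 * c ^ 2 + 2 * c + 1\<close>, and \<open>c \<le> 2 * K + 1\<close>; hence the
      quadratic bound in \<open>K\<close>.\<close>
    have "potential Z - 3 / 2 * (lg Z - lg Y') \<le> potential Y'"
      using Y'S SZ Y'ne finZ by (intro potential_subset) auto
    moreover have "lg Z - lg Y' \<le> 2 * c\<^sup>2 + 2 * c + 1" using SZ(3) lgY' unfolding c_eqs by linarith
    moreover have "potential Y \<le> potential Z" using Zm[of Y] Y(2) by simp
    moreover have "c \<le> 2 * real K + 1"
    proof -
      have "2 ^ (5 + j) \<le> 2 * K + 1" using cK jK by linarith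
      then have "real (2 ^ (5 + j)) \<le> real (2 * K + 1)" by (rule of_nat_mono)
      then show ?thesis unfolding c_def by simp
    qed
    then have "c\<^sup>2 \<le> (2 * real K + 1)\<^sup>2" using cpos by (intro power_mono) auto
    moreover have "(2 * real K + 1)\<^sup>2 = 4 * (real K)\<^sup>2 + 4 * real K + 1" by (simp add: power2_eq_square algebra_simps)
    moreover have "(real K + 1)\<^sup>2 = (real K)\<^sup>2 + 2 * real K + 1" by (simp add: power2_eq_square algebra_simps)
    moreover have "0 \<le> real K" by simp
    ultimately show ?thesis using \<open>c \<le> 2 * real K + 1\<close> by argo
  qed
  moreover have "Y' \<subseteq> Y" using Y'S SZ Z by blast
  ultimately show ?thesis using that jK lK Y'ne by blast
qed

text \<open>Traps pass to subsets, so each step adds a pair \<open>(j, l)\<close> to those already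
  present. Only \<open>(K + 1) * (2 * K + 3)\<close> pairs exist; a larger vertex set would have
  enough potential for one step more.\<close>

lemma lg_vertices_bound:
  assumes "V \<noteq> {}"
  shows "lg V < 1024 * real (card (cols V)) + 16 * ((real K + 1) * (2 * real K + 1))
    + real ((K + 1) * (2 * K + 3) + 1) * (12 * (real K + 1)\<^sup>2) + 2"
proof (rule ccontr)
  assume large: "\<not> ?thesis"
  define P where "P = (K + 1) * (2 * K + 3)"
  define L where "L = 12 * (real K + 1)\<^sup>2"
  define traps where "traps Y = {(j, l). j \<le> K \<and> l \<le> 2 * K + 2 \<and> trap j l Y}" for Y
  have L0: "0 \<le> L" unfolding L_def by simp
  have traps_sub: "traps Y \<subseteq> {..K} \<times> {..2 * K + 2}" for Y unfolding traps_def by auto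
  then have fin_traps: "finite (traps Y)" for Y by (rule finite_subset) simp
  have "(\<Sum>j\<le>K. richness j V) \<le> (\<Sum>j\<le>K. 2 * real K + 1)"
  proof (rule sum_mono)
    fix j assume "j \<in> {..K}"
    show "richness j V \<le> 2 * real K + 1"
    proof (cases "0 < richness j V")
      case True
      obtain Z' where "Z' \<subseteq> V" "Z' \<noteq> {}" "rich j Z'" using richness_pos[OF finV True] by metis
      then have "2 ^ (5 + j) \<le> K + j + 1" by (rule rich_bound)
      then have "2 ^ (5 + j) \<le> 2 * K + 1" using \<open>j \<in> {..K}\<close> by simp
      then have "real (2 ^ (5 + j)) \<le> real (2 * K + 1)" by (rule of_nat_mono)
      then show ?thesis using richness_le[OF finV, of j] by simp
    qed simp
  qed
  then have potV: "real (P + 1) * L + 2 \<le> potential V"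
    using large unfolding potential_def P_def L_def by (simp add: algebra_simps)
  have "\<exists>Y. Y \<subseteq> V \<and> Y \<noteq> {} \<and> potential V - real m * L \<le> potential Y \<and> m \<le> card (traps Y)" if "m \<le> P + 1" for m
    using that
  proof (induction m)
    case 0
    show ?case using assms by (intro exI[of _ V]) auto
  next
    case (Suc m)
    then obtain Y where Y: "Y \<subseteq> V" "Y \<noteq> {}" "potential V - real m * L \<le> potential Y" "m \<le> card (traps Y)" by auto
    have "real m * L \<le> real (P + 1) * L" using Suc.prems L0 by (intro mult_right_mono) auto
    then have "2 \<le> potential Y" using Y(3) potV by linarith
    from exists_new_trap[OF Y(1,2) this] obtain j l Y' where Y': "j \<le> K" "l \<le> 2 * K + 2" "Y' \<subseteq> Y" "Y' \<noteq> {}"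
      "potential Y - L \<le> potential Y'" "trap j l Y'" "\<not> trap j l Y" unfolding L_def by metis
    have "insert (j, l) (traps Y) \<subseteq> traps Y'" using Y' trap_mono[OF _ Y'(3)] unfolding traps_def by auto
    then have "card (insert (j, l) (traps Y)) \<le> card (traps Y')" by (intro card_mono fin_traps)
    moreover have "(j, l) \<notin> traps Y" using Y'(7) unfolding traps_def by simp
    ultimately have "Suc m \<le> card (traps Y')" using Y(4) fin_traps by simp
    moreover have "potential V - real (Suc m) * L \<le> potential Y'"
      using Y(3) Y'(5) by (simp add: algebra_simps)
    ultimately show ?case using Y' Y by (intro exI[of _ Y']) auto
  qed
  from this[of "P + 1"] obtain Y where "P + 1 \<le> card (traps Y)" by auto
  also have "\<dots> \<le> card ({..K} \<times> {..2 * K + 2})" by (intro card_mono traps_sub) simp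
  also have "\<dots> = P" unfolding P_def by (simp add: card_cartesian_product algebra_simps)
  finally show False by simp
qed

end

section \<open>The bound\<close>

lemma card_colors_on_four:
  assumes "distinct [w, w', x, x']" "{w, w', x, x'} \<subseteq> {..<n}" "\<forall>S \<in> [{..<n}]\<^bsup>4\<^esup>. \<not> card (colors_on c S) \<le> 2"
  shows "\<not> {c {w, w'}, c {w, x}, c {w, x'}, c {w', x}, c {w', x'}, c {x, x'}} \<subseteq> {a, b}"
proof
  assume sub: "{c {w, w'}, c {w, x}, c {w, x'}, c {w', x}, c {w', x'}, c {x, x'}} \<subseteq> {a, b}"
  let ?S = "{w, w', x, x'}"
  have "?S \<in> [{..<n}]\<^bsup>4\<^esup>" using assms(1,2) by (auto simp: nsets_def)
  moreover have "colors_on c ?S \<subseteq> {c {w, w'}, c {w, x}, c {w, x'}, c {w', x}, c {w', x'}, c {x, x'}}"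
  proof
    fix e assume "e \<in> colors_on c ?S"
    then obtain p q where pq: "e = c {p, q}" "p \<in> ?S" "q \<in> ?S" "p \<noteq> q"
      unfolding colors_on_def nsets_def by (auto simp: card_2_iff)
    then show "e \<in> {c {w, w'}, c {w, x}, c {w, x'}, c {w', x}, c {w', x'}, c {x, x'}}"
      by (elim insertE) (simp_all add: insert_commute)
  qed
  then have "card (colors_on c ?S) \<le> card {a, b}" using sub by (intro card_mono) auto
  moreover have "card {a, b} \<le> 2" by (simp add: card_insert_if)
  ultimately show False using assms(3) by force
qed

text \<open>With \<open>x = m + 2\<close>, the left side is at most \<open>69 * x ^ 4\<close>, and
  \<open>x ^ 4 \<le> 4 * 2 ^ m \<le> 4 * k\<close>. The figure 976 is what 2000 leaves after the
  weight 1024 of a colour.\<close>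

lemma polynomial_loss_bound:
  fixes k :: nat and K :: nat
  assumes "100 \<le> m" "2 ^ m \<le> real k" "K = m + 1"
  shows "16 * ((real K + 1) * (2 * real K + 1)) + real ((K + 1) * (2 * K + 3) + 1) * (12 * (real K + 1)\<^sup>2) + 2
    \<le> 976 * real k"
proof -
  define x where "x = real K + 1"
  have x: "100 \<le> x" "x = real (m + 2)" using assms unfolding x_def by auto
  have "real ((m + 2) ^ 4) \<le> real (2 ^ (m + 2))" using assms(1) by (intro of_nat_mono power4_le_exp2) simp
  then have x4: "x ^ 4 \<le> 4 * 2 ^ m" unfolding x(2) by simp
  have sq: "100 * x \<le> x\<^sup>2" using mult_right_mono[OF x(1), of x] x(1) by (simp add: power2_eq_square)
  have x22: "x\<^sup>2 * x\<^sup>2 = x ^ 4" by (simp flip: power_add)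
  have "1 * x\<^sup>2 \<le> x\<^sup>2 * x\<^sup>2" using sq x(1) by (intro mult_right_mono) auto
  then have x2: "x\<^sup>2 \<le> x ^ 4" using x22 by simp
  have "(real K + 1) * (2 * real K + 1) = 2 * x\<^sup>2 - x" unfolding x_def by (simp add: power2_eq_square algebra_simps)
  then have a: "16 * ((real K + 1) * (2 * real K + 1)) \<le> 32 * x ^ 4" using x2 x(1) by linarith
  have "real ((K + 1) * (2 * K + 3) + 1) = 2 * x\<^sup>2 + x + 1" unfolding x_def by (simp add: power2_eq_square algebra_simps)
  also have "\<dots> \<le> 3 * x\<^sup>2" using sq x(1) by linarith
  finally have "real ((K + 1) * (2 * K + 3) + 1) * (12 * x\<^sup>2) \<le> (3 * x\<^sup>2) * (12 * x\<^sup>2)" by (intro mult_right_mono) auto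
  also have "\<dots> = 36 * x ^ 4" using x22 by simp
  finally have "real ((K + 1) * (2 * K + 3) + 1) * (12 * (real K + 1)\<^sup>2) \<le> 36 * x ^ 4" unfolding x_def .
  moreover have "2 \<le> x ^ 4" using x2 sq x(1) by linarith
  ultimately show ?thesis using a x4 assms(2) by linarith
qed

lemma two_coloured_K4:
  fixes k :: nat
  assumes k: "2 ^ 100 < k" and n: "2 ^ (2000 * k) \<le> n" and c: "edge_coloring n k c"
  shows "\<exists>S \<in> [{..<n}]\<^bsup>4\<^esup>. card (colors_on c S) \<le> 2"
proof (rule ccontr)
  assume "\<not> ?thesis"
  then have many: "\<forall>S \<in> [{..<n}]\<^bsup>4\<^esup>. \<not> card (colors_on c S) \<le> 2" by blast
  have "1 \<le> real k" using k by simp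
  then obtain m :: nat where m: "2 ^ m \<le> real k" "real k < 2 ^ (m + 1)" by (rule power2_floor_log)
  have "real (2 ^ 100) < real k" using k by (rule less_imp_of_nat_less)
  then have "(2::real) ^ 100 < 2 ^ (m + 1)" using m(2) by simp
  then have "100 < m + 1" by (rule power_less_imp_less_exp[rotated]) simp
  then have m100: "100 \<le> m" by simp
  define K where "K = m + 1"
  have kK: "k \<le> 2 ^ K"
  proof -
    have "real k \<le> real (2 ^ K)" using m(2) unfolding K_def by simp
    then show ?thesis by (simp only: of_nat_le_iff)
  qed
  let ?C = "{c {x, y} | x y. x \<in> {..<n} \<and> y \<in> {..<n} \<and> x \<noteq> y}"
  have "?C \<subseteq> {..<k}"
  proof
    fix e assume "e \<in> ?C"
    then obtain x y where xy: "e = c {x, y}" "x < n" "y < n" "x \<noteq> y" by auto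
    then have "{x, y} \<in> [{..<n}]\<^bsup>2\<^esup>" by (auto simp: nsets_def)
    then show "e \<in> {..<k}" using c xy(1) unfolding edge_coloring_def by auto
  qed
  then have cardC: "card ?C \<le> k" using card_mono[of "{..<k}" ?C] by simp
  interpret no_two_coloured_K4 "\<lambda>x y. c {x, y}" "{..<n}" K
  proof
    fix w w' x x' b
    assume h: "w \<in> {..<n}" "w' \<in> {..<n}" "x \<in> {..<n}" "x' \<in> {..<n}" "distinct [w, w', x, x']"
      "c {w, x} = b" "c {w, x'} = b" "c {w', x} = b" "c {w', x'} = b"
    \<comment> \<open>If the diagonals agreed, the six edges would have only the colours
      \<open>b\<close> and \<open>c {x, x'}\<close>.\<close>
    show "c {w, w'} \<noteq> c {x, x'}"
      using card_colors_on_four[OF h(5) _ many, of b "c {x, x'}"] h by auto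
  next
    fix v x y z b
    assume h: "v \<in> {..<n}" "x \<in> {..<n}" "y \<in> {..<n}" "z \<in> {..<n}" "distinct [v, x, y, z]"
      "c {v, x} = b" "c {v, y} = b" "c {v, z} = b" "c {x, y} = b"
    \<comment> \<open>Otherwise five edges would have colour \<open>b\<close>, and only the edge
      \<open>{y, z}\<close> could have another.\<close>
    show "c {x, z} \<noteq> b"
      using card_colors_on_four[OF h(5) _ many, of b "c {y, z}"] h by auto
  next
    show "card ?C \<le> 2 ^ K" using cardC kK by linarith
  qed (auto simp: insert_commute)
  have n0: "0 < n" using n by (metis gr0I le_zero_eq power_eq_0_iff zero_neq_numeral)
  have "lg {..<n} < 1024 * real (card (cols {..<n})) + 16 * ((real K + 1) * (2 * real K + 1))
    + real ((K + 1) * (2 * K + 3) + 1) * (12 * (real K + 1)\<^sup>2) + 2"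
    using n0 by (intro lg_vertices_bound) auto
  moreover have "real (card (cols {..<n})) \<le> real k"
    unfolding cols_def using cardC by (rule of_nat_mono)
  moreover have "real (2000 * k) \<le> lg {..<n}"
  proof -
    have "real (2 ^ (2000 * k)) \<le> real n" using n by (rule of_nat_mono)
    then have "log 2 (2 ^ (2000 * k)) \<le> log 2 (real n)" using n0 by (subst log_le_cancel_iff) auto
    moreover have "log 2 (2 ^ (2000 * k)) = real (2000 * k)" by (subst log_nat_power) auto
    ultimately show ?thesis unfolding lg_def by simp
  qed
  ultimately show False
    using polynomial_loss_bound[OF m100 m(1) K_def] by simp
qed

theorem theorem1p1:
  fixes k :: nat
  assumes "k > 2 ^ 100"
  shows "g43 k < 2 ^ (2000 * k) \<and>
    (\<forall>n \<ge> 2 ^ (2000 * k). \<forall>c. edge_coloring n k c \<longrightarrow>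
       (\<exists>S \<in> [{..<n}]\<^bsup>4\<^esup>. card (colors_on c S) \<le> 2))"
proof
  let ?N = "{n. n > 0 \<and> (\<exists>c. edge_coloring n k c \<and> every_K4_three_colors n c)}"
  have bound: "n < 2 ^ (2000 * k)" if n: "n \<in> ?N" for n
  proof (rule ccontr)
    assume "\<not> n < 2 ^ (2000 * k)"
    moreover obtain c where "edge_coloring n k c" "every_K4_three_colors n c" using n by blast
    ultimately show False
      using two_coloured_K4[OF assms, of n c] unfolding every_K4_three_colors_def by force
  qed
  then have "finite ?N" by (intro finite_subset[of ?N "{..<2 ^ (2000 * k)}"]) auto
  \<comment> \<open>The one-vertex graph is admissible, so that \<open>Max\<close> is taken over a
    nonempty set.\<close>
  moreover have "[{..<1::nat}]\<^bsup>2\<^esup> = {}" "[{..<1::nat}]\<^bsup>4\<^esup> = {}"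
    by (auto intro!: nsets_eq_empty)
  then have "1 \<in> ?N" by (auto simp: edge_coloring_def every_K4_three_colors_def)
  ultimately show "g43 k < 2 ^ (2000 * k)"
    unfolding g43_def using bound Max_in[of ?N] by blast
  show "\<forall>n \<ge> 2 ^ (2000 * k). \<forall>c. edge_coloring n k c \<longrightarrow>
       (\<exists>S \<in> [{..<n}]\<^bsup>4\<^esup>. card (colors_on c S) \<le> 2)"
    using two_coloured_K4[OF assms] by blast
qed

end
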